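(* Let $f\in\mathcal{B}$ with $S(f)\subset J(f)$. If $U$ is a Siegel disk of $f$ which satisfies $S(f)\cap\partial U=\emptyset$, then $f\colon\partial U\to\partial U$ is a homeomorphism.
   Context: All closures and boundaries are taken in $\mathbb{C}$. For an entire function $f$, $J(f)$ denotes the Julia set; $\operatorname{sing}(f^{-1})$ consists of all finite critical values and finite asymptotic values of $f$, and $S(f):=\overline{\operatorname{sing}(f^{-1})}$ is the set of singular values. The Eremenko-Lyubich class $\mathcal{B}$ is the set of all transcendental entire functions $f\colon\mathbb{C}\to\mathbb{C}$ for which $S(f)$ is bounded. A Siegel disk of $f$ is a simply connected component $U$ of the Fatou set of $f$ with $f(U)=U$ such that $f|_U$ is conformally conjugate to an irrational rotation. *)

theory Defs
  imports "HOL-Complex_Analysis.Complex_Analysis" "HOL-Computational_Algebra.Polynomial"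
begin

definition transcendental_entire :: "(complex \<Rightarrow> complex) \<Rightarrow> bool" where
  "transcendental_entire f \<longleftrightarrow>
     f holomorphic_on UNIV \<and> \<not> (\<exists>p :: complex poly. \<forall>z. f z = poly p z)"

definition critical_values :: "(complex \<Rightarrow> complex) \<Rightarrow> complex set" where
  "critical_values f = f ` {c. deriv f c = 0}"

definition asymptotic_values :: "(complex \<Rightarrow> complex) \<Rightarrow> complex set" where
  "asymptotic_values f =
     {a. \<exists>\<gamma> :: real \<Rightarrow> complex. continuous_on {0..} \<gamma> \<and>
           filterlim \<gamma> at_infinity at_top \<and> ((\<lambda>t. f (\<gamma> t)) \<longlongrightarrow> a) at_top}"

definition sing_inverse :: "(complex \<Rightarrow> complex) \<Rightarrow> complex set" where
  "sing_inverse f = critical_values f \<union> asymptotic_values f"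

definition singular_values :: "(complex \<Rightarrow> complex) \<Rightarrow> complex set" where
  "singular_values f = closure (sing_inverse f)"

definition class_B :: "(complex \<Rightarrow> complex) set" where
  "class_B = {f. transcendental_entire f \<and> bounded (singular_values f)}"

text \<open>Normality on a domain in the sense of Montel, that is, with respect to the spherical
  metric: on a connected open set a locally uniform limit of holomorphic functions is either
  holomorphic or identically infinity. The definition is only meant for open connected \<open>D\<close>.\<close>

definition normal_family_on :: "(complex \<Rightarrow> complex) set \<Rightarrow> complex set \<Rightarrow> bool" where
  "normal_family_on \<F> D \<longleftrightarrow>
     (\<forall>F :: nat \<Rightarrow> complex \<Rightarrow> complex. range F \<subseteq> \<F> \<longrightarrow>
        (\<exists>r :: nat \<Rightarrow> nat. strict_mono r \<and>
           ((\<exists>g. g holomorphic_on D \<and>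
                (\<forall>K. compact K \<and> K \<subseteq> D \<longrightarrow> uniform_limit K (\<lambda>n. F (r n)) g sequentially)) \<or>
            (\<forall>K. compact K \<and> K \<subseteq> D \<longrightarrow>
                (\<forall>B. \<forall>\<^sub>F n in sequentially. \<forall>z\<in>K. norm (F (r n) z) \<ge> B)))))"

definition Fatou_set :: "(complex \<Rightarrow> complex) \<Rightarrow> complex set" where
  "Fatou_set f =
     {z. \<exists>D. open D \<and> connected D \<and> z \<in> D \<and> normal_family_on (range (\<lambda>n. f ^^ n)) D}"

definition Julia_set :: "(complex \<Rightarrow> complex) \<Rightarrow> complex set" where
  "Julia_set f = - Fatou_set f"

text \<open>The conformal conjugacy \<open>\<phi>\<close> maps \<open>U\<close> onto the unit disk; a holomorphic bijection between
  open sets has a holomorphic inverse.\<close>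

definition Siegel_disk :: "(complex \<Rightarrow> complex) \<Rightarrow> complex set \<Rightarrow> bool" where
  "Siegel_disk f U \<longleftrightarrow>
     U \<in> components (Fatou_set f) \<and> simply_connected U \<and> f ` U = U \<and>
     (\<exists>(\<phi> :: complex \<Rightarrow> complex) (\<theta> :: real). \<theta> \<notin> \<rat> \<and> \<phi> holomorphic_on U \<and> bij_betw \<phi> U (ball 0 1) \<and>
        (\<forall>z\<in>U. \<phi> (f z) = cis (2 * pi * \<theta>) * \<phi> z))"

end

theory Submission
  imports Defs
begin

text \<open>
  It suffices to find a simply connected domain \<open>\<Omega>\<close> that contains the closure of \<open>U\<close> and no singular
  value: the branch of the inverse of \<open>f\<close> that inverts \<open>f|U\<close> then extends to \<open>\<Omega>\<close> and inverts \<open>f\<close> on the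
  boundary of \<open>U\<close>. Since the set of singular values is compact, such an \<open>\<Omega>\<close> exists as soon as for
  every singular value \<open>s\<close> and every closed disk \<open>D\<close> around \<open>s\<close> disjoint from the closure of \<open>U\<close> there is
  an unbounded closed connected set \<open>A\<close> that touches \<open>D\<close> and misses the closure of \<open>U\<close>.

  A component of the complement of \<open>U\<close> is closed, connected and unbounded. Pulling it back twice
  under \<open>f\<close> inside a logarithmic tract gives infinitely many pairwise disjoint unbounded continua,
  told apart by an integer label, that do not meet \<open>U\<close>. As \<open>s\<close> is in the Julia set, some iterate of
  \<open>f\<close> maps \<open>D\<close> to a set meeting three of them; pulling back under this iterate gives three
  disjoint unbounded continua that touch \<open>D\<close> and do not meet \<open>U\<close>. They cannot all touch the closure
  of \<open>U\<close>, for otherwise they would join each of \<open>D\<close>, \<open>U\<close> and infinity, a planar drawing of the complete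
  bipartite graph on three and three vertices.
\<close>

section \<open>Unbounded continua\<close>

text \<open>Two pullbacks are made for the following reason. A component of the complement of
  \<open>U\<close> may wind around the origin, so its preimage under \<open>exp\<close> need not
  fall into pieces that can be told apart. The first pullback moves it into a tract, which omits 0
  and is the injective image of a half-plane, so a logarithm exists there. The preimage under
  \<open>exp\<close> of a set in the tract then splits into pieces indexed by integers, and the
  second pullback carries these back into the tract. Boundedness of the singular values serves
  twice: it provides the tracts, and by compactness finitely many disks and continua suffice. That
  they are in the Julia set also serves twice: it keeps them out of \<open>U\<close>, and it makes
  the iterates spread a small disk around a singular value. The obstacle is that nothing is known
  about the accessibility of boundary points of \<open>U\<close>. A continuum that meets the closure
  of \<open>U\<close> therefore yields no arc into \<open>U\<close>, and the planarity argument has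
  to replace the three continua by disjoint open neighbourhoods, which do meet
  \<open>U\<close>.\<close>

lemma unbounded_component_vimage:
  fixes h :: "complex \<Rightarrow> complex"
  assumes h: "h holomorphic_on UNIV" "\<not> h constant_on UNIV"
    and X: "closed X" "connected X" "\<not> bounded X" and w: "h w \<in> X"
  shows "closed (connected_component_set (h -` X) w)"
    and "\<not> bounded (connected_component_set (h -` X) w)"
proof -
  have cont: "continuous_on UNIV h"
    using h(1) holomorphic_on_imp_continuous_on by blast
  have clv: "closed (h -` X)"
    using cont X(1) continuous_closed_vimage continuous_on_eq_continuous_at open_UNIV by blast
  then show cl: "closed (connected_component_set (h -` X) w)"
    by (simp add: closed_connected_component)
  show "\<not> bounded (connected_component_set (h -` X) w)"
  proof
    assume bd: "bounded (connected_component_set (h -` X) w)"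
    let ?C = "connected_component_set (h -` X) w"
    have C: "?C \<in> components (h -` X)" using w by (auto simp: components_def)
    have comp: "compact ?C" using cl bd compact_eq_bounded_closed by blast
    obtain K where K: "openin (top_of_set (h -` X)) K" "compact K" "?C \<subseteq> K" "K \<subseteq> UNIV"
      using Sura_Bura_clopen_subset[OF closed_imp_locally_compact[OF clv] C comp open_UNIV] by auto
    obtain T where T: "open T" "K = h -` X \<inter> T" using K(1) by (auto simp: openin_open)
    have "compact (h ` K)" using K(2) cont compact_continuous_image continuous_on_subset by blast
    have hT: "open (h ` T)"
      using open_mapping_thm[OF h(1) open_UNIV connected_UNIV T(1) _ h(2)] by simp
    have eq: "h ` K = X \<inter> h ` T" using T(2) by auto
    have "openin (top_of_set X) (h ` K)" using eq hT by (auto simp: openin_open)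
    moreover have "closedin (top_of_set X) (h ` K)"
      using \<open>compact (h ` K)\<close> eq by (metis closed_subset compact_imp_closed inf_le1)
    ultimately have "h ` K = {} \<or> h ` K = X" using X(2) connected_clopen by blast
    moreover have "w \<in> K" using K(3) w by auto
    ultimately have "h ` K = X" by blast
    then show False using \<open>compact (h ` K)\<close> X(3) compact_imp_bounded by blast
  qed
qed

text \<open>A boundary bumping argument. If all components of \<open>X - ball s r\<close> through
  the sphere were bounded, then finitely many compact relatively clopen sets would cover the part of
  \<open>X\<close> on the sphere. What remains of \<open>X - ball s r\<close> outside their union
  \<open>L\<close> is clopen in \<open>X\<close>: it is empty, so that \<open>X\<close> is bounded,
  or all of \<open>X\<close>, so that \<open>X\<close> misses the closed ball.\<close>

lemma unbounded_component_outside_ball: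
  fixes X :: "complex set"
  assumes X: "closed X" "connected X" "\<not> bounded X" and meet: "X \<inter> cball s r \<noteq> {}"
  obtains Y where "Y \<subseteq> X" "closed Y" "connected Y" "\<not> bounded Y" "Y \<inter> ball s r = {}"
    "Y \<inter> sphere s r \<noteq> {}"
proof -
  define F where "F = X - ball s r"
  define F0 where "F0 = X \<inter> sphere s r"
  have clF: "closed F" unfolding F_def using X(1) by blast
  have F0F: "F0 \<subseteq> F" unfolding F_def F0_def by auto
  have cF0: "compact F0" unfolding F0_def using X(1) by (simp add: closed_Int_compact)
  have "\<exists>x\<in>F0. \<not> bounded (connected_component_set F x)"
  proof (rule ccontr)
    assume "\<not> ?thesis"
    then have bd: "bounded (connected_component_set F x)" if "x \<in> F0" for x using that by blast
    have "\<exists>K. openin (top_of_set F) K \<and> compact K \<and> x \<in> K" if x: "x \<in> F0" for x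
    proof -
      have C: "connected_component_set F x \<in> components F" using x F0F by (auto simp: components_def)
      have comp: "compact (connected_component_set F x)"
        using bd[OF x] clF closed_connected_component compact_eq_bounded_closed by blast
      obtain K where "openin (top_of_set F) K" "compact K" "connected_component_set F x \<subseteq> K"
        using Sura_Bura_clopen_subset[OF closed_imp_locally_compact[OF clF] C comp open_UNIV] by auto
      moreover have "x \<in> connected_component_set F x" using x F0F by auto
      ultimately show ?thesis by blast
    qed
    then obtain K where K: "\<And>x. x \<in> F0 \<Longrightarrow> openin (top_of_set F) (K x)" "\<And>x. x \<in> F0 \<Longrightarrow> compact (K x)"
      "\<And>x. x \<in> F0 \<Longrightarrow> x \<in> K x" by metis
    have "\<exists>T. open T \<and> K x = F \<inter> T" if "x \<in> F0" for x using K(1)[OF that] by (auto simp: openin_open)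
    then obtain T where T: "\<And>x. x \<in> F0 \<Longrightarrow> open (T x)" "\<And>x. x \<in> F0 \<Longrightarrow> K x = F \<inter> T x" by metis
    obtain I where I: "I \<subseteq> F0" "finite I" "F0 \<subseteq> (\<Union>x\<in>I. T x)"
    proof (rule compactE_image[OF cF0, of F0 T])
      show "F0 \<subseteq> (\<Union>c\<in>F0. T c)"
      proof
        fix x assume x: "x \<in> F0"
        then have "x \<in> T x" using K(3)[OF x] T(2)[OF x] by blast
        then show "x \<in> (\<Union>c\<in>F0. T c)" using x by blast
      qed
    qed (use T(1) in auto)
    define L where "L = (\<Union>x\<in>I. K x)"
    have cL: "compact L" unfolding L_def using I K(2) by (intro compact_UN) auto
    have opL: "openin (top_of_set F) L" unfolding L_def using K(1) I by (intro openin_Union) auto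
    have LF: "L \<subseteq> F" using opL openin_imp_subset by blast
    have F0L: "F0 \<subseteq> L" unfolding L_def using I T(2) F0F by blast
    obtain V where V: "open V" "L = F \<inter> V" using opL by (auto simp: openin_open)
    have "F - L = X \<inter> (- cball s r \<inter> - L)" 
    proof (intro equalityI subsetI)
      fix x assume x: "x \<in> F - L"
      then have "x \<notin> F0" using F0L by blast
      then show "x \<in> X \<inter> (- cball s r \<inter> - L)"
        using x unfolding F_def F0_def by auto
    next
      fix x assume "x \<in> X \<inter> (- cball s r \<inter> - L)"
      then show "x \<in> F - L" unfolding F_def by auto
    qed
    then have 1: "openin (top_of_set X) (F - L)"
      by (simp add: cL compact_imp_closed openin_open_Int open_Compl open_Int)
    have "F - L = X \<inter> (F \<inter> - V)" using V by (auto simp: F_def)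
    then have 2: "closedin (top_of_set X) (F - L)"
      by (metis V(1) clF closed_Compl closed_Int closedin_closed_Int)
    have "F - L = {} \<or> F - L = X" using 1 2 X(2) connected_clopen by blast
    then show False
    proof
      assume "F - L = {}"
      then have "bounded F" using LF cL compact_imp_bounded by (metis Diff_eq_empty_iff bounded_subset)
      then have "bounded (F \<union> ball s r)" by simp
      then show False using X(3) bounded_subset[of _ X] unfolding F_def by auto
    next
      assume "F - L = X"
      have "x \<notin> cball s r" if "x \<in> X" for x
      proof
        assume "x \<in> cball s r"
        moreover have "x \<in> F - L" using that \<open>F - L = X\<close> by simp
        ultimately have "x \<in> F0" using that unfolding F_def F0_def by auto
        then show False using \<open>x \<in> F - L\<close> F0L by blast
      qed
      then show False using meet by blast
    qed
  qed
  then obtain x where x: "x \<in> F0" "\<not> bounded (connected_component_set F x)" by blast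
  show ?thesis
  proof (rule that[of "connected_component_set F x"])
    show "connected_component_set F x \<subseteq> X" "connected_component_set F x \<inter> ball s r = {}"
      using connected_component_subset[of F x] by (auto simp: F_def)
    show "connected_component_set F x \<inter> sphere s r \<noteq> {}"
    proof -
      have "x \<in> connected_component_set F x" using x F0F by auto
      then show ?thesis using x(1) unfolding F0_def by blast
    qed
  qed (use x clF closed_connected_component in auto)
qed

lemma unbounded_closed_connected_subset_norm_ge:
  fixes X :: "complex set"
  assumes "closed X" "connected X" "\<not> bounded X"
  obtains Y where "Y \<subseteq> X" "closed Y" "connected Y" "\<not> bounded Y" "\<And>z. z \<in> Y \<Longrightarrow> r \<le> cmod z"
proof (cases "X \<inter> cball 0 r = {}")
  case True
  then show ?thesis using that[of X] assms by (force simp: not_le)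
next
  case False
  then show ?thesis
    using unbounded_component_outside_ball[OF assms False]
    by (metis disjoint_iff mem_ball_0 not_less that)
qed

section \<open>Three unbounded continua touching a disk and a domain\<close>

text \<open>If no arc were inside the other two, then crossing \<open>c1\<close> at an interior point would not change the
  winding number of the loop through \<open>c2\<close> and \<open>c3\<close>, which is zero there; so the loops through \<open>c1, c2\<close>
  and through \<open>c1, c3\<close> would have the same inside.\<close>

lemma theta_curve_arc_inside:
  fixes c1 c2 c3 :: "real \<Rightarrow> complex"
  assumes c1: "arc c1" "pathstart c1 = a" "pathfinish c1 = b"
    and c2: "arc c2" "pathstart c2 = a" "pathfinish c2 = b"
    and c3: "arc c3" "pathstart c3 = a" "pathfinish c3 = b"
    and int: "path_image c1 \<inter> path_image c2 = {a,b}" "path_image c1 \<inter> path_image c3 = {a,b}"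
      "path_image c2 \<inter> path_image c3 = {a,b}"
  shows "path_image c3 \<inter> inside (path_image c1 \<union> path_image c2) \<noteq> {} \<or>
         path_image c2 \<inter> inside (path_image c1 \<union> path_image c3) \<noteq> {} \<or>
         path_image c1 \<inter> inside (path_image c2 \<union> path_image c3) \<noteq> {}"
proof (rule ccontr)
  assume "\<not> ?thesis"
  then have out: "path_image c3 \<inter> inside (path_image c1 \<union> path_image c2) = {}"
    "path_image c2 \<inter> inside (path_image c1 \<union> path_image c3) = {}"
    "path_image c1 \<inter> inside (path_image c2 \<union> path_image c3) = {}" by auto
  define J12 J13 J23 where J: "J12 = c1 +++ reversepath c2" "J13 = c1 +++ reversepath c3"
    "J23 = c2 +++ reversepath c3"
  have sp: "simple_path J12" "simple_path J13" "simple_path J23"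
    unfolding J using c1 c2 c3 int by (auto simp: simple_path_join_loop_eq arc_reversepath)
  have cl: "pathfinish J12 = pathstart J12" "pathfinish J13 = pathstart J13" "pathfinish J23 = pathstart J23"
    unfolding J using c1 c2 c3 by auto
  have im: "path_image J12 = path_image c1 \<union> path_image c2" "path_image J13 = path_image c1 \<union> path_image c3"
    "path_image J23 = path_image c2 \<union> path_image c3"
    unfolding J using c1 c2 c3 by (auto simp: path_image_join)
  have pth: "path c1" "path c2" "path c3" "path J12" "path J13" "path J23"
    using c1 c2 c3 sp by (auto simp: arc_imp_path simple_path_imp_path)
  define x where "x = c1 (1/2)"
  have mid: "c (1/2) \<noteq> a \<and> c (1/2) \<noteq> b \<and> c (1/2) \<in> path_image c"
    if "arc c" "pathstart c = a" "pathfinish c = b" for c :: "real \<Rightarrow> complex"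
    using that unfolding arc_def path_image_def pathstart_def pathfinish_def inj_on_def by force
  have x: "x \<in> path_image c1" "x \<noteq> a" "x \<noteq> b" using mid[of c1] c1 by (auto simp: x_def)
  then have xn: "x \<notin> path_image J23" using int im by blast
  have "open (- path_image J23)" using pth closed_path_image by blast
  then obtain e where e: "e > 0" "ball x e \<subseteq> - path_image J23"
    using xn open_contains_ball[of "- path_image J23"] by auto
  have "x \<in> outside (path_image J23)"
    using xn x(1) out(3) im(3) by (metis ComplI UnE disjoint_iff inside_Un_outside)
  then have w0: "winding_number J23 x = 0"
    using winding_number_zero_in_outside cl pth by blast
  have w0': "winding_number J23 z = 0" if "z \<in> ball x e" for z
    using winding_number_eq[OF pth(6) cl(3), of x "ball x e" z] e w0 that by auto
  have JO: "connected (inside (path_image J12))" "connected (inside (path_image J13))"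
    "frontier (inside (path_image J12)) = path_image J12"
    "frontier (inside (path_image J13)) = path_image J13"
    using Jordan_inside_outside[OF sp(1) cl(1)] Jordan_inside_outside[OF sp(2) cl(2)] by auto
  have "x \<in> closure (inside (path_image J12))" using x(1) im(1) JO(3) by (auto simp: frontier_def)
  then obtain z where z: "z \<in> inside (path_image J12)" "dist z x < e"
    using e(1) closure_approachable by metis
  have zn: "z \<notin> path_image c1" "z \<notin> path_image c2" "z \<notin> path_image c3"
    using z(1) out(1) inside_no_overlap[of "path_image J12"] unfolding im(1) by blast+
  have "winding_number J12 z = winding_number c1 z - winding_number c2 z"
    "winding_number J13 z = winding_number c1 z - winding_number c3 z"
    "winding_number J23 z = winding_number c2 z - winding_number c3 z"
    unfolding J using c1 c2 c3 pth zn by (auto simp: winding_number_join winding_number_reversepath)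
  moreover have "winding_number J23 z = 0" using w0' z(2) by (simp add: dist_commute)
  ultimately have "winding_number J13 z = winding_number J12 z" by simp
  moreover have "cmod (winding_number J12 z) = 1"
    using simple_closed_path_norm_winding_number_inside sp z by blast
  ultimately have "winding_number J13 z \<noteq> 0" by auto
  then have "z \<notin> outside (path_image J13)" using winding_number_zero_in_outside cl pth by blast
  then have z13: "z \<in> inside (path_image J13)"
    using zn im(2) by (metis ComplI Un_iff inside_Un_outside)
  have ov: "inside (path_image J12) \<inter> path_image c1 = {}" "inside (path_image J12) \<inter> path_image c3 = {}"
    "inside (path_image J13) \<inter> path_image c1 = {}" "inside (path_image J13) \<inter> path_image c2 = {}"
    using out(1,2) inside_no_overlap[of "path_image c1 \<union> path_image c2"]
      inside_no_overlap[of "path_image c1 \<union> path_image c3"] unfolding im(1,2) by blast+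
  have d1: "inside (path_image J12) \<inter> frontier (inside (path_image J13)) = {}"
    by (metis JO(4) im(2) Int_Un_distrib ov(1,2) Un_empty_left)
  have d2: "inside (path_image J13) \<inter> frontier (inside (path_image J12)) = {}"
    by (metis JO(3) im(1) Int_Un_distrib ov(3,4) Un_empty_left)
  \<comment> \<open>Neither inside meets the frontier of the other, and both are connected and
    contain \<open>z\<close>; so they coincide. Their frontiers then coincide too, which squeezes
    \<open>c3\<close> into its two endpoints.\<close>
  have "inside (path_image J12) \<subseteq> inside (path_image J13)"
    using connected_Int_frontier[OF JO(1), of "inside (path_image J13)"] d1 z(1) z13 by blast
  moreover have "inside (path_image J13) \<subseteq> inside (path_image J12)"
    using connected_Int_frontier[OF JO(2), of "inside (path_image J12)"] d2 z(1) z13 by blast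
  ultimately have "path_image J12 = path_image J13" using JO(3,4) by (metis subset_antisym)
  then have "path_image c3 \<subseteq> path_image c1 \<union> path_image c2" using im(1,2) by simp
  then have "path_image c3 \<subseteq> {a,b}" using int(2,3) by blast
  then show False using mid[of c3] c3 by blast
qed

lemma connected_half_open_segment:
  fixes a b :: "'a::euclidean_space"
  shows "connected (closed_segment a b - {a})"
proof (cases "a = b")
  case False
  have "closed_segment a b - {a} = (\<lambda>u. (1 - u) *\<^sub>R a + u *\<^sub>R b) ` {0<..1}"
  proof (intro equalityI subsetI)
    fix x assume "x \<in> closed_segment a b - {a}"
    then obtain u where "0 \<le> u" "u \<le> 1" "x = (1 - u) *\<^sub>R a + u *\<^sub>R b" "x \<noteq> a"
      by (metis DiffD1 DiffD2 in_segment(1) singletonI)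
    then show "x \<in> (\<lambda>u. (1 - u) *\<^sub>R a + u *\<^sub>R b) ` {0<..1}"
      by (cases "u = 0") auto
  next
    fix x assume "x \<in> (\<lambda>u. (1 - u) *\<^sub>R a + u *\<^sub>R b) ` {0<..1}"
    then obtain u where u: "0 < u" "u \<le> 1" "x = (1 - u) *\<^sub>R a + u *\<^sub>R b" by auto
    then have "x - a = u *\<^sub>R (b - a)" by (simp add: algebra_simps)
    then have "x \<noteq> a" using u(1) False by auto
    then show "x \<in> closed_segment a b - {a}" using u unfolding in_segment Diff_iff by (metis less_imp_le singletonD)
  qed
  moreover have "connected ((\<lambda>u. (1 - u) *\<^sub>R a + u *\<^sub>R b) ` {0<..1::real})"
    by (intro connected_continuous_image continuous_intros) simp
  ultimately show ?thesis by simp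
qed simp

text \<open>Otherwise join \<open>s\<close> to a point of \<open>U\<close> by three arcs, each following one \<open>A i\<close>, that start radially in the
  disk and end along the image of a radius of the unit disk. One of them is inside the other two,
  and so is then the unbounded \<open>A i\<close> it follows.\<close>

lemma three_unbounded_continua:
  fixes A :: "nat \<Rightarrow> complex set"
  assumes hom: "homeomorphism (ball (0::complex) 1) U \<psi> \<psi>'" and U: "open U"
    and A: "\<And>i. i < 3 \<Longrightarrow> closed (A i)" "\<And>i. i < 3 \<Longrightarrow> connected (A i)" "\<And>i. i < 3 \<Longrightarrow> \<not> bounded (A i)"
      "\<And>i. i < 3 \<Longrightarrow> A i \<inter> ball s e = {}" "\<And>i. i < 3 \<Longrightarrow> A i \<inter> sphere s e \<noteq> {}"
      "\<And>i. i < 3 \<Longrightarrow> A i \<inter> U = {}"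
    and disj: "\<And>i j. i < 3 \<Longrightarrow> j < 3 \<Longrightarrow> i \<noteq> j \<Longrightarrow> A i \<inter> A j = {}"
    and e: "0 < e" and sU: "closure U \<inter> cball s e = {}"
  shows "\<exists>i<3. A i \<inter> closure U = {}"
proof (rule ccontr)
  assume "\<not> ?thesis"
  then have "\<exists>b. b \<in> A i \<inter> closure U" if "i < 3" for i using that by blast
  then obtain b where b: "\<And>i. i < 3 \<Longrightarrow> b i \<in> A i \<inter> closure U" by metis
  have "\<exists>p. p \<in> A i \<inter> sphere s e" if "i < 3" for i using A(5)[OF that] by blast
  then obtain p where p: "\<And>i. i < 3 \<Longrightarrow> p i \<in> A i" "\<And>i. i < 3 \<Longrightarrow> dist s (p i) = e"
    by (metis IntD1 IntD2 mem_sphere)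
  have U_sub: "U \<inter> cball s e = {}" using sU closure_subset by blast
  have seg_ball: "x \<in> ball s e" if sb: "x \<in> closed_segment s (p i)" "x \<noteq> p i" "i < 3" for x i
  proof -
    obtain u where u: "0 \<le> u" "u \<le> 1" "x = (1 - u) *\<^sub>R s + u *\<^sub>R p i"
      using sb(1) unfolding in_segment by blast
    have "u \<noteq> 1" using u sb(2) by auto
    have "x - s = u *\<^sub>R (p i - s)" using u(3) by (simp add: algebra_simps)
    then have "cmod (x - s) = u * cmod (p i - s)" using u(1) by simp
    then have "dist s x = u * e" using p(2)[OF sb(3)]
      by (metis dist_norm norm_minus_commute)
    then show ?thesis using u \<open>u \<noteq> 1\<close> e by simp
  qed
  have seg_A: "closed_segment s (p i) \<inter> A j = {}" if "i < 3" "j < 3" "i \<noteq> j" for i j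
    using seg_ball[OF _ _ that(1)] A(4)[OF that(2)] p(1)[OF that(1)] disj[OF that] by blast
  have seg_seg: "closed_segment s (p i) \<inter> closed_segment s (p j) \<subseteq> {s}" if "i < 3" "j < 3" "i \<noteq> j" for i j
  proof
    fix x assume x: "x \<in> closed_segment s (p i) \<inter> closed_segment s (p j)"
    obtain u v where uv: "0 \<le> u" "x = (1 - u) *\<^sub>R s + u *\<^sub>R p i" "0 \<le> v" "x = (1 - v) *\<^sub>R s + v *\<^sub>R p j"
      using x unfolding in_segment Int_iff by blast
    have d: "x - s = u *\<^sub>R (p i - s)" using uv(2) by (simp add: algebra_simps)
    have d': "x - s = v *\<^sub>R (p j - s)" using uv(4) by (simp add: algebra_simps)
    have "cmod (x - s) = u * cmod (p i - s)" using d uv(1) by simp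
    then have n1: "cmod (x - s) = u * e" using p(2)[OF that(1)] by (metis dist_norm norm_minus_commute)
    have "cmod (x - s) = v * cmod (p j - s)" using d' uv(3) by simp
    then have "cmod (x - s) = v * e" using p(2)[OF that(2)] by (metis dist_norm norm_minus_commute)
    then have "u = v" using n1 e by simp
    have "p i \<noteq> p j" using disj[OF that] p(1)[OF that(1)] p(1)[OF that(2)] by (metis disjoint_iff)
    then have "u = 0" using d d' \<open>u = v\<close> by auto
    then show "x \<in> {s}" using d by simp
  qed
  \<comment> \<open>\<open>C i\<close> is what the path following \<open>A i\<close> has to avoid
    outside \<open>U\<close>: the other two continua and their radial segments in the disk.\<close>
  define C where "C i = (\<Union>j\<in>{..<3}-{i}. A j \<union> closed_segment s (p j))" for i
  have clC: "closed (C i)" for i unfolding C_def using A(1) by (intro closed_UN) auto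
  have C_ne: "C i \<noteq> {}" for i
  proof -
    have "(if i = 0 then 1 else 0) \<in> {..<3::nat} - {i}" by auto
    then show ?thesis unfolding C_def by blast
  qed
  have CA: "A j \<subseteq> C i" "closed_segment s (p j) \<subseteq> C i" if "j < 3" "i \<noteq> j" for i j
    unfolding C_def using that by blast+
  have AC: "A i \<inter> C i = {}" if "i < 3" for i
    unfolding C_def using disj[OF that] seg_A[OF _ that] by fastforce
  \<comment> \<open>\<open>b i\<close> need not be accessible from \<open>U\<close>, so no path
    inside the union of \<open>A i\<close> and \<open>U\<close> is available. The open neighbourhood
    \<open>N i\<close> of \<open>A i\<close> is path connected and meets \<open>U\<close>. Comparing
    the distances to \<open>A i\<close> and to \<open>C i\<close> makes these neighbourhoods
    pairwise disjoint, because \<open>A j\<close> is part of \<open>C i\<close>.\<close>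
  define N where "N i = connected_component_set {x. infdist x (A i) < infdist x (C i)} (p i)" for i
  have opO: "open {x. infdist x (A i) < infdist x (C i)}" for i
    by (intro open_Collect_less continuous_intros)
  have opN: "open (N i)" for i unfolding N_def using opO by (rule open_connected_component)
  have conN: "connected (N i)" for i unfolding N_def by simp
  have N_sub: "infdist x (A i) < infdist x (C i)" if "x \<in> N i" for x i
    using that connected_component_subset unfolding N_def by fastforce
  have A_ne: "A i \<noteq> {}" if "i < 3" for i using p(1)[OF that] by blast
  have AN: "A i \<subseteq> N i" if "i < 3" for i
    unfolding N_def
  proof (rule connected_component_maximal[OF p(1)[OF that] A(2)[OF that]], rule subsetI)
    fix x assume "x \<in> A i"
    then have "infdist x (A i) = 0" "x \<notin> C i" using AC[OF that] by auto
    then show "x \<in> {x. infdist x (A i) < infdist x (C i)}"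
      using infdist_pos_not_in_closed[OF clC C_ne] by simp
  qed
  have NN: "N i \<inter> N j = {}" if "i < 3" "j < 3" "i \<noteq> j" for i j
  proof (rule ccontr)
    assume "N i \<inter> N j \<noteq> {}"
    then obtain x where x: "x \<in> N i" "x \<in> N j" by blast
    have "infdist x (C i) \<le> infdist x (A j)" "infdist x (C j) \<le> infdist x (A i)"
      using infdist_mono CA that A_ne by metis+
    then show False using N_sub[OF x(1)] N_sub[OF x(2)] by linarith
  qed
  have N_seg: "N i \<inter> closed_segment s (p j) = {}" if "i < 3" "j < 3" "i \<noteq> j" for i j
  proof (rule ccontr)
    assume "N i \<inter> closed_segment s (p j) \<noteq> {}"
    then obtain x where x: "x \<in> N i" "x \<in> closed_segment s (p j)" by blast
    then have "infdist x (C i) = 0" using CA that by (metis infdist_zero subsetD)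
    then show False using N_sub[OF x(1)] infdist_nonneg[of x "A i"] by linarith
  qed
  have "\<exists>u. u \<in> N i \<inter> U" if "i < 3" for i
  proof -
    have "b i \<in> N i" using AN b that by blast
    then show ?thesis using b[OF that] opN[of i] by (metis IntD2 IntI closure_iff_nhds_not_empty disjoint_iff Int_commute open_Int_closure_eq_empty)
  qed
  then obtain u where u: "\<And>i. i < 3 \<Longrightarrow> u i \<in> N i" "\<And>i. i < 3 \<Longrightarrow> u i \<in> U" by (metis IntE)
  have \<psi>': "\<psi>' x \<in> ball 0 1" "\<psi> (\<psi>' x) = x" if "x \<in> U" for x
    using hom that unfolding homeomorphism_def by auto
  have \<psi>: "\<psi> x \<in> U" "\<psi>' (\<psi> x) = x" if "x \<in> ball 0 1" for x
    using hom that unfolding homeomorphism_def by auto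
  have cont\<psi>: "continuous_on (ball 0 1) \<psi>" using hom unfolding homeomorphism_def by blast
  \<comment> \<open>All points \<open>\<psi>' (u i)\<close> are in the closed disk of radius
    \<open>\<rho>\<close>, so a path from \<open>p i\<close> to \<open>u i\<close> must enter its
    image \<open>Y\<close>. The value 1/2 only keeps the radius positive.\<close>
  define \<rho> where "\<rho> = Max (insert (1/2) ((\<lambda>i. norm (\<psi>' (u i))) ` {..<3}))"
  have \<rho>: "1/2 \<le> \<rho>" "\<And>i. i < 3 \<Longrightarrow> norm (\<psi>' (u i)) \<le> \<rho>"
    unfolding \<rho>_def by (rule Max_ge; simp)+
  have \<rho>1: "\<rho> < 1"
    unfolding \<rho>_def using \<psi>'(1) u(2) by (subst Max_less_iff) auto
  define Y where "Y = \<psi> ` cball 0 \<rho>"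
  have cb: "cball (0::complex) \<rho> \<subseteq> ball 0 1" using \<rho>1 by auto
  have YU: "Y \<subseteq> U" unfolding Y_def using \<psi>(1) cb by blast
  have "compact Y" unfolding Y_def using cont\<psi> cb continuous_on_subset compact_cball
    by (metis compact_continuous_image)
  then have clY: "closed Y" by (rule compact_imp_closed)
  define z0 where "z0 = \<psi> 0"
  have z0Y: "z0 \<in> Y" unfolding z0_def Y_def using \<rho>(1) by auto
  have opY: "open (\<psi> ` ball 0 \<rho>)"
  proof -
    have "openin (top_of_set (ball 0 1)) (ball (0::complex) \<rho>)"
      using cb ball_subset_cball by (metis open_ball open_openin openin_open_eq order_trans open_subset)
    then have "openin (top_of_set U) (\<psi> ` ball 0 \<rho>)"
      using homeomorphism_imp_open_map[OF hom] by blast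
    then show ?thesis using U openin_open_trans by blast
  qed
  have pU: "p i \<notin> U" if "i < 3" for i using p(1)[OF that] A(6)[OF that] by blast
  define P where "P i h \<longleftrightarrow> path h \<and> pathstart h = p i \<and> path_image h \<subseteq> N i \<and> path_image h - {pathfinish h} \<subseteq> - Y
     \<and> pathfinish h \<in> Y \<and> norm (\<psi>' (pathfinish h)) = \<rho>" for i h
  have "\<exists>h. P i h" if i: "i < 3" for i
  proof -
    have "path_connected (N i)" using opN conN connected_open_path_connected by blast
    moreover have "p i \<in> N i" using AN p(1) i by blast
    ultimately obtain q where q: "path q" "path_image q \<subseteq> N i" "pathstart q = p i" "pathfinish q = u i"
      using u(1)[OF i] unfolding path_connected_def by metis
    have uY: "u i \<in> Y" unfolding Y_def using \<psi>'(2)[OF u(2)[OF i]] \<rho>(2)[OF i]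
      by (metis image_eqI mem_cball_0)
    have op: "open (- Y)" using clY by blast
    have pc: "pathstart q \<in> closure (- Y)" unfolding q(3) using pU[OF i] YU closure_subset[of "- Y"] by blast
    have "pathfinish q \<notin> - Y" using q(4) uY by simp
    then obtain h where h: "path h" "pathstart h = pathstart q" "path_image h \<subseteq> path_image q"
      "path_image h - {pathfinish h} \<subseteq> interior (- Y)" "pathfinish h \<in> frontier (- Y)"
      using exists_path_subpath_to_frontier[OF q(1) pc] by metis
    have fY: "pathfinish h \<in> frontier Y" using h(5) by simp
    then have hY: "pathfinish h \<in> Y" using clY frontier_subset_closed by blast
    have "pathfinish h \<notin> interior Y" using fY by (simp add: frontier_def)
    moreover have "\<psi> ` ball 0 \<rho> \<subseteq> interior Y"
      using opY by (intro interior_maximal) (auto simp: Y_def)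
    ultimately have "pathfinish h \<notin> \<psi> ` ball 0 \<rho>" by blast
    moreover obtain x where x: "x \<in> cball 0 \<rho>" "pathfinish h = \<psi> x" using hY unfolding Y_def by blast
    moreover have "\<psi>' (pathfinish h) = x" using x \<psi>(2) cb by auto
    ultimately have "norm (\<psi>' (pathfinish h)) = \<rho>" by (auto simp: image_iff)
    then show ?thesis unfolding P_def using h q hY op interior_open by (metis order_trans)
  qed
  then obtain h where "\<And>i. i < 3 \<Longrightarrow> P i (h i)" by metis
  then have h: "\<And>i. i < 3 \<Longrightarrow> path (h i)" "\<And>i. i < 3 \<Longrightarrow> pathstart (h i) = p i"
    "\<And>i. i < 3 \<Longrightarrow> path_image (h i) \<subseteq> N i"
    "\<And>i. i < 3 \<Longrightarrow> path_image (h i) - {pathfinish (h i)} \<subseteq> - Y"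
    "\<And>i. i < 3 \<Longrightarrow> pathfinish (h i) \<in> Y" "\<And>i. i < 3 \<Longrightarrow> norm (\<psi>' (pathfinish (h i))) = \<rho>"
    unfolding P_def by blast+
  define y where "y i = pathfinish (h i)" for i
  have hN: "y i \<in> N i" if "i < 3" for i using h(3)[OF that] unfolding y_def by auto
  define w where "w i = \<psi>' (y i)" for i
  have w: "norm (w i) = \<rho>" "\<psi> (w i) = y i" if "i < 3" for i
    using h(5,6)[OF that] \<psi>'(2) YU unfolding w_def y_def by auto
  have segb: "closed_segment 0 (w i) \<subseteq> cball 0 \<rho>" if "i < 3" for i
    using w(1)[OF that] \<rho>(1) by (intro closed_segment_subset) auto
  define leg where "leg i = \<psi> \<circ> linepath (w i) 0" for i
  have leg: "path (leg i)" "pathstart (leg i) = y i" "pathfinish (leg i) = z0"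
    "path_image (leg i) = \<psi> ` closed_segment 0 (w i)" if "i < 3" for i
  proof -
    show "path (leg i)" unfolding leg_def
      using segb[OF that] cb cont\<psi> 
      by (intro path_continuous_image) (auto simp: closed_segment_commute intro: continuous_on_subset)
    show "path_image (leg i) = \<psi> ` closed_segment 0 (w i)" unfolding leg_def
      by (simp add: path_image_compose closed_segment_commute)
  qed (auto simp: leg_def pathstart_compose pathfinish_compose w(2)[OF that] z0_def)
  have legY: "path_image (leg i) \<subseteq> Y" if "i < 3" for i
    using leg(4)[OF that] segb[OF that] unfolding Y_def by blast
  have leg_leg: "path_image (leg i) \<inter> path_image (leg j) \<subseteq> {z0}" if ij: "i < 3" "j < 3" "i \<noteq> j" for i j
  proof
    fix x assume "x \<in> path_image (leg i) \<inter> path_image (leg j)"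
    then obtain v v' where v: "v \<in> closed_segment 0 (w i)" "v' \<in> closed_segment 0 (w j)" "x = \<psi> v" "x = \<psi> v'"
      using leg(4) ij by auto
    then have "v = v'" using \<psi>(2) segb ij cb by (metis subsetD)
    obtain a b where ab: "0 \<le> a" "v = a *\<^sub>R w i" "0 \<le> b" "v' = b *\<^sub>R w j"
      using v(1,2) unfolding in_segment by auto
    then have "norm v = a * \<rho>" "norm v' = b * \<rho>" using w(1) ij by auto
    then have "a = b" using \<open>v = v'\<close> \<rho>(1) by auto
    have "y i \<noteq> y j" using hN[OF ij(1)] hN[OF ij(2)] NN[OF ij] by (metis disjoint_iff)
    then have "w i \<noteq> w j" using w(2) ij by metis
    then have "a = 0" using ab \<open>v = v'\<close> \<open>a = b\<close> by auto
    then show "x \<in> {z0}" using ab v z0_def by simp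
  qed
  define r where "r i = linepath s (p i) +++ (h i +++ leg i)" for i
  have r: "path (r i)" "pathstart (r i) = s" "pathfinish (r i) = z0"
    "path_image (r i) = closed_segment s (p i) \<union> path_image (h i) \<union> path_image (leg i)" if "i < 3" for i
    unfolding r_def using h(1,2)[OF that] leg[OF that] by (auto simp: path_image_join y_def)
  have segY: "closed_segment s (p i) \<inter> Y = {}" if "i < 3" for i
    using seg_ball[OF _ _ that] YU U_sub pU[OF that] ball_subset_cball by blast
  have hY: "path_image (h i) \<inter> Y \<subseteq> {y i}" if "i < 3" for i using h(4)[OF that] y_def by auto
  have rr: "path_image (r i) \<inter> path_image (r j) \<subseteq> {s, z0}" if ij: "i < 3" "j < 3" "i \<noteq> j" for i j
  proof -
    have "y i \<notin> path_image (leg j)" if ij: "i < 3" "j < 3" "i \<noteq> j" for i j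
    proof
      assume "y i \<in> path_image (leg j)"
      moreover have "y i \<in> path_image (leg i)" using leg(2)[OF ij(1)] by (metis pathstart_in_path_image)
      ultimately have "y i = z0" using leg_leg[OF ij] by blast
      then have "w i = 0" using \<psi>(2)[of 0] unfolding w_def z0_def by simp
      then show False using w(1)[OF ij(1)] \<rho>(1) by simp
    qed
    note 1 = this[OF ij] this[OF ij(2,1) ij(3)[symmetric]]
    have "path_image (h i) \<inter> path_image (leg j) = {}" "path_image (h j) \<inter> path_image (leg i) = {}"
      using 1 hY[OF ij(1)] hY[OF ij(2)] legY[OF ij(1)] legY[OF ij(2)] by blast+
    moreover have "path_image (h i) \<inter> path_image (h j) = {}" using h(3) NN ij by blast
    moreover have "path_image (h i) \<inter> closed_segment s (p j) = {}" "path_image (h j) \<inter> closed_segment s (p i) = {}"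
      using h(3) N_seg ij by blast+
    moreover have "closed_segment s (p i) \<inter> path_image (leg j) = {}" "closed_segment s (p j) \<inter> path_image (leg i) = {}"
      using segY legY ij by blast+
    ultimately show ?thesis
      using seg_seg[OF ij] leg_leg[OF ij] unfolding r(4)[OF ij(1)] r(4)[OF ij(2)]
      by (auto simp: Int_Un_distrib Int_Un_distrib2 Int_commute)
  qed
  have "s \<noteq> z0" using z0Y YU U_sub e by (metis centre_in_cball disjoint_iff less_imp_le subsetD)
  then have "\<exists>c. arc c \<and> path_image c \<subseteq> path_image (r i) \<and> pathstart c = s \<and> pathfinish c = z0" if "i < 3" for i
    using path_contains_arc[OF r(1-3)[OF that]] by metis
  then obtain c where c: "\<And>i. i < 3 \<Longrightarrow> arc (c i)" "\<And>i. i < 3 \<Longrightarrow> path_image (c i) \<subseteq> path_image (r i)"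
    "\<And>i. i < 3 \<Longrightarrow> pathstart (c i) = s" "\<And>i. i < 3 \<Longrightarrow> pathfinish (c i) = z0" by metis
  have cends: "s \<in> path_image (c i)" "z0 \<in> path_image (c i)" if "i < 3" for i
    using c(3,4)[OF that] by (metis pathstart_in_path_image, metis pathfinish_in_path_image)
  have cc: "path_image (c i) \<inter> path_image (c j) = {s, z0}" if "i < 3" "j < 3" "i \<noteq> j" for i j
    using c(2)[OF that(1)] c(2)[OF that(2)] rr[OF that] cends[OF that(1)] cends[OF that(2)] by blast
  \<comment> \<open>\<open>G i\<close> is the path \<open>r i\<close> without its shared ends
    \<open>s\<close> and \<open>z0\<close>, with the whole of \<open>A i\<close> attached at
    \<open>p i\<close>. It is connected and unbounded and misses the other two paths; the ends are
    removed because those paths contain them.\<close>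
  define G where "G i = (closed_segment s (p i) - {s}) \<union> A i \<union> path_image (h i) \<union> \<psi> ` (closed_segment 0 (w i) - {0})" for i
  have conG: "connected (G i)" if "i < 3" for i
  proof -
    have "p i \<noteq> s" using p(2)[OF that] e by auto
    have "connected ((closed_segment s (p i) - {s}) \<union> A i)"
      using A(2)[OF that] p(1)[OF that] \<open>p i \<noteq> s\<close> connected_half_open_segment
      by (intro connected_Un) auto
    then have 1: "connected ((closed_segment s (p i) - {s}) \<union> A i \<union> path_image (h i))"
    proof (rule connected_Un)
      show "((closed_segment s (p i) - {s}) \<union> A i) \<inter> path_image (h i) \<noteq> {}"
        using p(1)[OF that] h(2)[OF that] pathstart_in_path_image[of "h i"] by auto
    qed (use h(1)[OF that] connected_path_image in auto)
    have 2: "connected (\<psi> ` (closed_segment 0 (w i) - {0}))"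
      using cont\<psi> segb[OF that] cb
      by (intro connected_continuous_image connected_half_open_segment continuous_on_subset[OF cont\<psi>]) blast
    have "w i \<noteq> 0" using w(1)[OF that] \<rho>(1) by auto
    then have "y i \<in> \<psi> ` (closed_segment 0 (w i) - {0})" using w(2)[OF that] by force
    moreover have "y i \<in> path_image (h i)" unfolding y_def by (rule pathfinish_in_path_image)
    ultimately show ?thesis unfolding G_def by (intro connected_Un[OF 1 2]) blast
  qed
  have Gr: "path_image (r i) - {s, z0} \<subseteq> G i" if "i < 3" for i
    unfolding r(4)[OF that] leg(4)[OF that] G_def z0_def by auto
  have Gsub: "G i \<subseteq> (path_image (r i) - {s, z0}) \<union> A i" if "i < 3" for i
  proof -
    have "s \<notin> path_image (h i)" 
    proof
      assume "s \<in> path_image (h i)"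
      moreover obtain j where "j < 3" "j \<noteq> i" by (metis less_numeral_extra(3) zero_less_numeral one_less_numeral_iff semiring_norm(77) zero_neq_one)
      ultimately show False using h(3)[OF that] N_seg[OF that] by force
    qed
    moreover have "z0 \<notin> path_image (h i)"
    proof
      assume "z0 \<in> path_image (h i)"
      then have "z0 = y i" using hY[OF that] z0Y by blast
      then have "w i = 0" using \<psi>(2)[of 0] unfolding w_def z0_def by simp
      then show False using w(1)[OF that] \<rho>(1) by simp
    qed
    moreover have "z0 \<notin> closed_segment s (p i)" using segY[OF that] z0Y by blast
    moreover have "s \<notin> \<psi> ` (closed_segment 0 (w i) - {0})" 
      using legY[OF that] leg(4)[OF that] segY[OF that] by auto
    moreover have "z0 \<notin> \<psi> ` (closed_segment 0 (w i) - {0})"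
    proof
      assume "z0 \<in> \<psi> ` (closed_segment 0 (w i) - {0})"
      then obtain v where "v \<in> closed_segment 0 (w i)" "v \<noteq> 0" "\<psi> v = \<psi> 0" unfolding z0_def by force
      then show False using \<psi>(2)[of v] \<psi>(2)[of 0] segb[OF that] cb by auto
    qed
    ultimately show ?thesis unfolding r(4)[OF that] leg(4)[OF that] G_def by blast
  qed
  have Ar: "A i \<inter> path_image (r j) = {}" if "i < 3" "j < 3" "i \<noteq> j" for i j
  proof -
    have "A i \<inter> closed_segment s (p j) = {}" using seg_A that by blast
    moreover have "A i \<inter> path_image (h j) = {}" using AN NN h(3) that by blast
    moreover have "A i \<inter> path_image (leg j) = {}" using legY[OF that(2)] YU A(6)[OF that(1)] by blast
    ultimately show ?thesis unfolding r(4)[OF that(2)] by blast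
  qed
  have Gdis: "G i \<inter> path_image (r j) = {}" if "i < 3" "j < 3" "i \<noteq> j" for i j
    using Gsub[OF that(1)] Ar[OF that] rr[OF that] by blast
  have Gub: "\<not> bounded (G i)" if "i < 3" for i
    using A(3)[OF that] bounded_subset[of "G i" "A i"] unfolding G_def by blast
  \<comment> \<open>A point of \<open>c i\<close> inside the loop formed by the other two arcs would
    put all of the unbounded connected set \<open>G i\<close> there.\<close>
  have no: "path_image (c i) \<inter> inside (path_image (c j) \<union> path_image (c k)) = {}"
    if ijk: "i < 3" "j < 3" "k < 3" "i \<noteq> j" "i \<noteq> k" for i j k
  proof (rule ccontr)
    let ?T = "path_image (c j) \<union> path_image (c k)"
    assume "path_image (c i) \<inter> inside ?T \<noteq> {}"
    then obtain x where x: "x \<in> path_image (c i)" "x \<in> inside ?T" by blast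
    have "x \<notin> ?T" "bounded (connected_component_set (- ?T) x)" using x(2) by (auto simp: inside_def)
    moreover have "x \<in> G i" using x(1) c(2)[OF ijk(1)] cends[OF ijk(2)] \<open>x \<notin> ?T\<close> Gr[OF ijk(1)] by blast
    moreover have "G i \<subseteq> - ?T"
      using Gdis[OF ijk(1,2,4)] Gdis[OF ijk(1,3,5)] c(2)[OF ijk(2)] c(2)[OF ijk(3)] by blast
    ultimately have "bounded (G i)"
      using connected_component_maximal[OF _ conG[OF ijk(1)]] bounded_subset by metis
    then show False using Gub ijk by blast
  qed
  show False
    using theta_curve_arc_inside[of "c 0" s z0 "c 1" "c 2"] c(1,3,4) cc no[of 2 0 1] no[of 1 0 2] no[of 0 1 2]
    by simp
qed

section \<open>Lifting through an entire function away from its singular values\<close>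

lemma nonzero_deriv_if_regular_value:
  "f z \<notin> singular_values f \<Longrightarrow> deriv f z \<noteq> 0"
  unfolding singular_values_def sing_inverse_def critical_values_def
  using closure_subset[of "f ` {c. deriv f c = 0} \<union> asymptotic_values f"] by blast

lemma local_inverse_at_regular_value:
  assumes f: "f holomorphic_on UNIV" and z: "f z \<notin> singular_values f"
  obtains r d h where "0 < r" "0 < d" "continuous_on (ball (f z) d) h" "h (f z) = z"
    "\<And>w. w \<in> ball (f z) d \<Longrightarrow> f (h w) = w"
    "\<And>x. x \<in> ball z r \<Longrightarrow> f x \<in> ball (f z) d \<Longrightarrow> h (f x) = x"
proof -
  obtain r where r: "r > 0" "open (f ` ball z r)" "inj_on f (ball z r)"
    using has_complex_derivative_locally_invertible[OF f _ open_UNIV nonzero_deriv_if_regular_value[OF z]]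
    by blast
  have cont: "continuous_on (ball z r) f"
    using f holomorphic_on_imp_continuous_on holomorphic_on_subset by blast
  obtain h where h: "homeomorphism (ball z r) (f ` ball z r) f h"
    using invariance_of_domain_homeomorphism[OF open_ball cont _ r(3)] by blast
  obtain d where d: "d > 0" "ball (f z) d \<subseteq> f ` ball z r"
    using r(1,2) open_contains_ball[of "f ` ball z r"] by (metis centre_in_ball imageI)
  show ?thesis
  proof (rule that[OF r(1) d(1)])
    show "continuous_on (ball (f z) d) h"
      using h d(2) unfolding homeomorphism_def by (metis continuous_on_subset)
    show "h (f z) = z" using h r(1) unfolding homeomorphism_def by simp
    show "f (h w) = w" if "w \<in> ball (f z) d" for w
      using h that d(2) unfolding homeomorphism_def by (metis subsetD)
    show "h (f x) = x" if "x \<in> ball z r" for x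
      using h that unfolding homeomorphism_def by blast
  qed
qed

text \<open>No covering property is used: \<open>f\<close> is injective near a point over a regular
  value, so the set where two lifts agree is open, and by continuity it is closed. This lemma
  identifies lifts throughout the development.\<close>

lemma lift_unique:
  fixes u v :: "'a::topological_space \<Rightarrow> complex"
  assumes f: "f holomorphic_on UNIV" and Q: "connected Q"
    and u: "continuous_on Q u" and v: "continuous_on Q v"
    and eq: "\<And>x. x \<in> Q \<Longrightarrow> f (u x) = f (v x)"
    and reg: "\<And>x. x \<in> Q \<Longrightarrow> f (u x) \<notin> singular_values f"
    and x0: "x0 \<in> Q" "u x0 = v x0" and x: "x \<in> Q"
  shows "u x = v x"
proof -
  define E where "E = {x\<in>Q. u x = v x}"
  have "E = Q \<inter> (\<lambda>x. u x - v x) -` {0}" unfolding E_def by auto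
  moreover have "continuous_on Q (\<lambda>x. u x - v x)" using u v by (intro continuous_intros)
  ultimately have cl: "closedin (top_of_set Q) E"
    using continuous_closedin_preimage by (metis closed_singleton)
  have op: "openin (top_of_set Q) E"
  proof (subst openin_subopen, intro ballI)
    fix y assume y: "y \<in> E"
    then have yQ: "y \<in> Q" "u y = v y" unfolding E_def by auto
    obtain r where r: "r > 0" "inj_on f (ball (u y) r)"
      using has_complex_derivative_locally_injective[OF f _ open_UNIV nonzero_deriv_if_regular_value[OF reg[OF yQ(1)]]]
      by blast
    define T where "T = (Q \<inter> u -` ball (u y) r) \<inter> (Q \<inter> v -` ball (u y) r)"
    have "openin (top_of_set Q) T"
      unfolding T_def using u v by (intro openin_Int continuous_openin_preimage_gen) auto
    moreover have "y \<in> T" unfolding T_def using yQ r(1) by auto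
    moreover have "T \<subseteq> E"
      unfolding T_def E_def using r(2) eq by (auto simp: inj_on_def)
    ultimately show "\<exists>T. openin (top_of_set Q) T \<and> y \<in> T \<and> T \<subseteq> E" by blast
  qed
  have "E = {} \<or> E = Q" using cl op Q connected_clopen by blast
  then show ?thesis using x0 x unfolding E_def by blast
qed

lemma asymptotic_value_from_half_open_interval:
  fixes q :: "real \<Rightarrow> complex"
  assumes s: "0 < s" and q: "continuous_on {0..<s} q" "filterlim q at_infinity (at_left s)"
    and lim: "((\<lambda>t. f (q t)) \<longlongrightarrow> a) (at_left s)"
  shows "a \<in> asymptotic_values f"
proof -
  \<comment> \<open>An asymptotic path is parametrized by \<open>{0..}\<close>;
    \<open>\<tau>\<close> maps this half-line into \<open>{0..<s}\<close> and tends to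
    \<open>s\<close> from below.\<close>
  define \<tau> where "\<tau> t = s * (t / (1 + t))" for t :: real
  have im: "\<tau> t \<in> {0..<s}" if "0 \<le> t" for t
  proof -
    have "t / (1 + t) < 1" "0 \<le> t / (1 + t)" using that by (auto simp: field_simps)
    then show ?thesis unfolding \<tau>_def using s mult_strict_left_mono[of "t / (1+t)" 1 s] by (metis atLeastLessThan_iff less_imp_le mult.right_neutral mult_nonneg_nonneg)
  qed
  have "((\<lambda>t::real. 1 - inverse (1 + t)) \<longlongrightarrow> 1 - 0) at_top"
    by (intro tendsto_intros tendsto_inverse_0_at_top filterlim_tendsto_add_at_top[OF tendsto_const filterlim_ident])
  then have "((\<lambda>t::real. s * (1 - inverse (1 + t))) \<longlongrightarrow> s * 1) at_top"
    by (intro tendsto_intros) auto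
  moreover have "eventually (\<lambda>t::real. s * (1 - inverse (1 + t)) = \<tau> t) at_top"
    using eventually_ge_at_top[of 0] by eventually_elim (auto simp: \<tau>_def field_simps)
  ultimately have "(\<tau> \<longlongrightarrow> s) at_top" using tendsto_cong by force
  moreover have "eventually (\<lambda>t. \<tau> t < s) at_top"
    using eventually_ge_at_top[of 0] by eventually_elim (use im in auto)
  ultimately have \<tau>: "filterlim \<tau> (at_left s) at_top"
    unfolding filterlim_at by (auto elim: eventually_mono)
  have "continuous_on {0..} \<tau>" unfolding \<tau>_def by (intro continuous_intros) auto
  then have "continuous_on {0..} (q \<circ> \<tau>)"
    using q(1) im by (intro continuous_on_compose) (auto intro: continuous_on_subset)
  moreover have "filterlim (q \<circ> \<tau>) at_infinity at_top"
    unfolding comp_def using filterlim_compose[OF q(2) \<tau>] .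
  moreover have "((\<lambda>t. f ((q \<circ> \<tau>) t)) \<longlongrightarrow> a) at_top"
    unfolding comp_def using filterlim_compose[OF lim \<tau>] .
  ultimately show ?thesis unfolding asymptotic_values_def by blast
qed

text \<open>A lift that cannot be continued beyond a parameter tends to infinity there, which exhibits an
  asymptotic value.\<close>

lemma lift_path:
  fixes p :: "real \<Rightarrow> complex"
  assumes f: "f holomorphic_on UNIV" and p: "continuous_on {0..1} p"
    and reg: "\<And>t. t \<in> {0..1} \<Longrightarrow> p t \<notin> singular_values f" and z0: "f z0 = p 0"
  obtains q where "continuous_on {0..1} q" "q 0 = z0" "\<And>t. t \<in> {0..1} \<Longrightarrow> f (q t) = p t"
proof -
  define lifts where "lifts t q \<longleftrightarrow> continuous_on {0..t} q \<and> q 0 = z0 \<and> (\<forall>s\<in>{0..t}. f (q s) = p s)"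
    for t :: real and q
  define L where "L = {t\<in>{0..1}. \<exists>q. lifts t q}"
  have contf: "continuous_on UNIV f" using f holomorphic_on_imp_continuous_on by blast
  have "lifts 0 (\<lambda>_. z0)" unfolding lifts_def using z0 by auto
  then have L0: "0 \<in> L" unfolding L_def by auto
  have down: "t' \<in> L" if tt: "t \<in> L" "0 \<le> t'" "t' \<le> t" for t t'
  proof -
    obtain q where "lifts t q" using tt unfolding L_def by blast
    moreover have "{0..t'} \<subseteq> {0..t}" using tt by auto
    ultimately have "lifts t' q" unfolding lifts_def by (metis continuous_on_subset subsetD)
    then show ?thesis using tt unfolding L_def by auto
  qed
  have "\<exists>q. lifts t q" if "t \<in> L" for t using that unfolding L_def by blast
  then obtain Q where Q: "\<And>t. t \<in> L \<Longrightarrow> lifts t (Q t)" by metis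
  \<comment> \<open>The value at \<open>t\<close> of a lift on \<open>{0..t}\<close>. By uniqueness
    all these lifts restrict to one another, so \<open>q\<close> is a single lift on all of
    \<open>L\<close>.\<close>
  define q where "q t = Q t t" for t
  have coh: "q s = Q t s" if ts: "t \<in> L" "0 \<le> s" "s \<le> t" for s t
  proof -
    have sL: "s \<in> L" using down ts by blast
    have "Q s s = Q t s"
    proof (rule lift_unique[OF f, of "{0..s}" "Q s" "Q t" 0])
      show "continuous_on {0..s} (Q s)" "continuous_on {0..s} (Q t)"
        using Q[OF sL] Q[OF ts(1)] ts(3) unfolding lifts_def by (auto intro: continuous_on_subset)
      show "f (Q s x) = f (Q t x)" "f (Q s x) \<notin> singular_values f" if "x \<in> {0..s}" for x
        using Q[OF sL] Q[OF ts(1)] ts that reg[of x] unfolding lifts_def L_def by auto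
      show "Q s 0 = Q t 0" using Q[OF sL] Q[OF ts(1)] unfolding lifts_def by auto
    qed (use ts in auto)
    then show ?thesis unfolding q_def .
  qed
  have qc: "continuous_on {0..t} q" if "t \<in> L" for t
    using Q[OF that] coh[OF that] unfolding lifts_def by (metis (no_types, lifting) atLeastAtMost_iff continuous_on_cong)
  have fq: "f (q t) = p t" if "t \<in> L" for t
    using Q[OF that] that unfolding lifts_def q_def L_def by auto
  have q0: "q 0 = z0" using Q[OF L0] unfolding lifts_def q_def by auto
  define s where "s = Sup L"
  have bdd: "bdd_above L" unfolding L_def by (auto intro: bdd_aboveI[of _ 1])
  have s01: "0 \<le> s" "s \<le> 1" unfolding s_def using L0 bdd
    by (auto intro!: cSup_upper cSup_least) (auto simp: L_def)
  have below: "t \<in> L" if "0 \<le> t" "t < s" for t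
    using less_cSupD[of L t] L0 that down unfolding s_def by (metis empty_iff less_imp_le)
  \<comment> \<open>Only an accumulation point \<open>z\<close> of \<open>q\<close> is found, not a
    limit. This is enough: one parameter \<open>t0\<close> close to \<open>s\<close> with
    \<open>q t0\<close> close to \<open>z\<close> lets the local inverse at \<open>z\<close> take
    over from \<open>q\<close>.\<close>
  have "\<exists>z. f z = p s \<and> (\<forall>r>0. \<forall>e>0. \<exists>t\<in>L. t \<le> s \<and> s - e < t \<and> q t \<in> ball z r)"
  proof (cases "s \<in> L")
    case True
    then show ?thesis using fq[OF True] by (intro exI[of _ "q s"]) force
  next
    case False
    then have s0: "0 < s" using L0 s01 by (metis order_le_less)
    have cq: "continuous_on {0..<s} q"
      unfolding continuous_on_eq_continuous_within
    proof
      fix t assume t: "t \<in> {0..<s}"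
      then have m: "(t + s) / 2 \<in> L" using below by auto
      have "continuous (at t within {0..(t+s)/2}) q"
        using qc[OF m] t by (auto simp: continuous_on_eq_continuous_within)
      moreover have "at t within {0..(t+s)/2} = at t within {0..<s}"
        by (rule at_within_nhd[of _ "{..<(t+s)/2}"]) (use t in auto)
      ultimately show "continuous (at t within {0..<s}) q" by simp
    qed
    have ps: "((\<lambda>t. p t) \<longlongrightarrow> p s) (at s within {0..<s})"
    proof (rule tendsto_within_subset)
      show "(p \<longlongrightarrow> p s) (at s within {0..1})" using p s01 unfolding continuous_on_def by auto
    qed (use s01 in auto)
    have al: "at_left s = at s within {0..<s}"
      by (rule at_within_nhd[of _ "{0<..}"]) (use s0 in auto)
    have "eventually (\<lambda>t. t \<in> {0..<s}) (at s within {0..<s})" by (simp add: eventually_at_filter)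
    then have "eventually (\<lambda>t. p t = f (q t)) (at s within {0..<s})"
      by eventually_elim (use fq below in auto)
    then have "((\<lambda>t. f (q t)) \<longlongrightarrow> p s) (at_left s)"
      unfolding al using ps by (rule tendsto_cong[THEN iffD1])
    then have "\<not> filterlim q at_infinity (at_left s)"
      using asymptotic_value_from_half_open_interval[OF s0 cq] reg[of s] s01
        closure_subset[of "sing_inverse f"]
      unfolding singular_values_def sing_inverse_def by auto
    then obtain B where B: "\<not> eventually (\<lambda>t. B \<le> norm (q t)) (at_left s)"
      unfolding filterlim_at_infinity[OF order_refl] by blast
    have "\<exists>t. t \<in> L \<and> s - e < t \<and> t < s \<and> norm (q t) < B" if "e > 0" for e
    proof (rule ccontr)
      assume "\<not> ?thesis"
      then have "\<forall>t. max 0 (s - e) < t \<and> t < s \<longrightarrow> B \<le> norm (q t)" using below by force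
      moreover have m: "max 0 (s - e) < s" using that s0 by auto
      ultimately show False using B unfolding eventually_at_left[OF m] by metis
    qed
    then have "\<exists>t. t \<in> L \<and> s - 1 / Suc n < t \<and> t < s \<and> norm (q t) < B" for n :: nat by simp
    then obtain T where T: "\<And>n. T n \<in> L" "\<And>n. s - 1 / Suc n < T n" "\<And>n. T n < s" "\<And>n. norm (q (T n)) < B"
      by metis
    have "\<forall>n. q (T n) \<in> cball 0 B" using T(4) by (auto intro: less_imp_le)
    then obtain z \<sigma> where z: "strict_mono (\<sigma> :: nat \<Rightarrow> nat)" "((\<lambda>n. q (T n)) \<circ> \<sigma>) \<longlonglongrightarrow> z"
      using compact_cball[of "0::complex" B] unfolding compact_def by metis
    have Ts: "T \<longlonglongrightarrow> s"
    proof (rule tendsto_sandwich[of "\<lambda>n. s - 1 / Suc n"])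
      show "(\<lambda>n. s - 1 / Suc n) \<longlonglongrightarrow> s"
        using tendsto_diff[OF tendsto_const LIMSEQ_Suc[OF lim_1_over_n], of s] by simp
    qed (use T(2,3) in \<open>auto intro!: always_eventually less_imp_le simp del: of_nat_Suc\<close>)
    have "(\<lambda>n. f (q (T (\<sigma> n)))) \<longlonglongrightarrow> f z"
      using z(2) contf unfolding comp_def
      by (auto intro: isCont_tendsto_compose simp: continuous_on_eq_continuous_at)
    then have "(\<lambda>n. p (T (\<sigma> n))) \<longlonglongrightarrow> f z" by (simp add: fq[OF T(1)])
    moreover have "(\<lambda>n. p (T (\<sigma> n))) \<longlonglongrightarrow> p s"
      using continuous_on_tendsto_compose[OF p LIMSEQ_subseq_LIMSEQ[OF Ts z(1), unfolded comp_def]] s01 T(1)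
      unfolding L_def by auto
    ultimately have "f z = p s" by (rule LIMSEQ_unique)
    moreover have "\<exists>t\<in>L. t \<le> s \<and> s - e < t \<and> q t \<in> ball z r" if "r > 0" "e > 0" for r e
    proof -
      have "eventually (\<lambda>n. q (T (\<sigma> n)) \<in> ball z r) sequentially"
        using z(2) that(1) unfolding comp_def tendsto_iff by (auto simp: dist_commute)
      moreover have "eventually (\<lambda>n. s - e < T (\<sigma> n)) sequentially"
        using order_tendstoD(1)[OF LIMSEQ_subseq_LIMSEQ[OF Ts z(1), unfolded comp_def], of "s - e"] that(2) by simp
      ultimately have "eventually (\<lambda>n. q (T (\<sigma> n)) \<in> ball z r \<and> s - e < T (\<sigma> n)) sequentially"
        by eventually_elim auto
      then obtain n where "q (T (\<sigma> n)) \<in> ball z r" "s - e < T (\<sigma> n)"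
        by (auto simp: eventually_sequentially)
      then show ?thesis using T(1,3) by (meson less_imp_le)
    qed
    ultimately show ?thesis by blast
  qed
  then obtain z where z: "f z = p s" "\<And>r e. r > 0 \<Longrightarrow> e > 0 \<Longrightarrow> \<exists>t\<in>L. t \<le> s \<and> s - e < t \<and> q t \<in> ball z r"
    by blast
  have "f z \<notin> singular_values f" using z(1) reg s01 by auto
  then obtain r d h where h: "0 < r" "0 < d" "continuous_on (ball (f z) d) h" 
    "\<And>w. w \<in> ball (f z) d \<Longrightarrow> f (h w) = w"
    "\<And>x. x \<in> ball z r \<Longrightarrow> f x \<in> ball (f z) d \<Longrightarrow> h (f x) = x"
    using local_inverse_at_regular_value[OF f] by metis
  obtain e where e: "e > 0" "\<And>t. t \<in> {0..1} \<Longrightarrow> dist t s < e \<Longrightarrow> dist (p t) (p s) < d"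
    using p s01 h(2) unfolding continuous_on_iff by (metis atLeastAtMost_iff)
  obtain t0 where t0: "t0 \<in> L" "t0 \<le> s" "s - e < t0" "q t0 \<in> ball z r"
    using z(2)[OF h(1) e(1)] by blast
  \<comment> \<open>\<open>t1\<close> is larger than \<open>s\<close> unless it is 1. As the
    extended lift puts \<open>t1\<close> into \<open>L\<close>, the choice of \<open>s\<close> as
    supremum leaves only \<open>t1 = 1\<close>.\<close>
  define t1 where "t1 = min 1 (s + e / 2)"
  have t1: "t0 \<le> t1" "0 \<le> t1" "t1 \<le> 1" using t0 s01 e(1) unfolding t1_def L_def by auto
  have pin: "p t \<in> ball (f z) d" if "t \<in> {t0..t1}" for t
  proof -
    have "t \<in> {0..1}" using that t0(1) t1 unfolding L_def by auto
    moreover have "dist t s < e" using that t0 e(1) unfolding t1_def dist_real_def by auto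
    ultimately have "dist (p t) (f z) < d" using e(2) z(1) by simp
    then show ?thesis by (simp add: dist_commute)
  qed
  define q' where "q' t = (if t \<le> t0 then q t else h (p t))" for t
  have glue: "q t0 = h (p t0)" using h(5)[OF t0(4)] fq[OF t0(1)] pin t1 by auto
  have t00: "0 \<le> t0" using t0(1) unfolding L_def by auto
  have "continuous_on ({0..t0} \<union> {t0..t1}) q'"
    unfolding q'_def
  proof (rule continuous_on_cases)
    show "continuous_on {0..t0} q" using qc t0 by blast
    show "continuous_on {t0..t1} (\<lambda>t. h (p t))"
      by (rule continuous_on_compose2[OF h(3)])
         (use p t00 t1 pin in \<open>auto intro: continuous_on_subset\<close>)
    show "\<forall>t. t \<in> {0..t0} \<and> \<not> t \<le> t0 \<or> t \<in> {t0..t1} \<and> t \<le> t0 \<longrightarrow> q t = h (p t)"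
      using glue by auto
  qed auto
  moreover have "{0..t0} \<union> {t0..t1} = {0..t1}" using t00 t1 by auto
  ultimately have c': "continuous_on {0..t1} q'" by simp
  have f': "f (q' t) = p t" if "t \<in> {0..t1}" for t
    unfolding q'_def using that fq[OF down[OF t0(1)]] h(4) pin by auto
  have "lifts t1 q'" unfolding lifts_def using c' f' q0 t00 by (auto simp: q'_def)
  then have t1L: "t1 \<in> L" unfolding L_def using t1 by auto
  then have "t1 \<le> s" unfolding s_def using bdd cSup_upper by blast
  then have "t1 = 1" using e(1) unfolding t1_def by auto
  then show ?thesis using that[of q'] c' f' q0 t00 by (auto simp: q'_def)
qed

text \<open>\<open>G w\<close> is the endpoint of the lift of the radius to \<open>w\<close>. This
  makes \<open>G\<close> continuous along each radius only; joint continuity is carried outward from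
  the centre along a radius.\<close>

lemma lift_ball:
  fixes \<psi> :: "complex \<Rightarrow> complex"
  assumes f: "f holomorphic_on UNIV" and \<psi>: "continuous_on (ball 0 1) \<psi>"
    and reg: "\<And>w. w \<in> ball 0 1 \<Longrightarrow> \<psi> w \<notin> singular_values f" and z0: "f z0 = \<psi> 0"
  obtains G where "continuous_on (ball 0 1) G" "G 0 = z0" "\<And>w. w \<in> ball 0 1 \<Longrightarrow> f (G w) = \<psi> w"
proof -
  have scale: "t *\<^sub>R w \<in> ball 0 1" if "w \<in> ball 0 1" "0 \<le> t" "t \<le> 1" for t and w :: complex
    using that mult_left_le_one_le[of "norm w" t] by (simp add: mult.commute)
  define P where "P w q \<longleftrightarrow> continuous_on {0..1} q \<and> q 0 = z0 \<and> (\<forall>t\<in>{0..1}. f (q t) = \<psi> (t *\<^sub>R w))"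
    for w and q :: "real \<Rightarrow> complex"
  have "\<exists>q. P w q" if w: "w \<in> ball 0 1" for w
  proof -
    have c: "continuous_on {0..1} (\<lambda>t. \<psi> (t *\<^sub>R w))"
      by (rule continuous_on_compose2[OF \<psi>]) (use scale[OF w] in \<open>auto intro!: continuous_intros\<close>)
    obtain q where "continuous_on {0..1} q" "q 0 = z0" "\<And>t. t \<in> {0..1} \<Longrightarrow> f (q t) = \<psi> (t *\<^sub>R w)"
      by (rule lift_path[OF f c, of z0]) (use scale[OF w] reg z0 in auto)
    then show ?thesis unfolding P_def by blast
  qed
  then obtain Q where Q: "\<And>w. w \<in> ball 0 1 \<Longrightarrow> P w (Q w)" by metis
  define G where "G w = Q w 1" for w
  have radial: "Q w t = G (t *\<^sub>R w)" if w: "w \<in> ball 0 1" and t: "0 \<le> t" "t \<le> 1" for w t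
  proof -
    have tw: "t *\<^sub>R w \<in> ball 0 1" using scale w t by blast
    have st: "s * t \<in> {0..1}" if "s \<in> {0..1}" for s
      using that t mult_le_one[of s t] by auto
    have "Q w (1 * t) = Q (t *\<^sub>R w) 1"
    proof (rule lift_unique[OF f, of "{0..1::real}" "\<lambda>s. Q w (s * t)" "Q (t *\<^sub>R w)" 0])
      show "continuous_on {0..1} (\<lambda>s. Q w (s * t))"
        by (rule continuous_on_compose2[of "{0..1}" "Q w"])
           (use Q[OF w] st in \<open>auto simp: P_def intro!: continuous_intros\<close>)
      show "continuous_on {0..1} (Q (t *\<^sub>R w))" using Q[OF tw] unfolding P_def by blast
      show "f (Q w (s * t)) = f (Q (t *\<^sub>R w) s)" "f (Q w (s * t)) \<notin> singular_values f" if "s \<in> {0..1}" for s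
        using Q[OF w] Q[OF tw] st[OF that] that reg scale[OF w] unfolding P_def by auto
      show "Q w (0 * t) = Q (t *\<^sub>R w) 0" using Q[OF w] Q[OF tw] unfolding P_def by simp
    qed auto
    then show ?thesis unfolding G_def by simp
  qed
  have Gf: "f (G w) = \<psi> w" if "w \<in> ball 0 1" for w
    using Q[OF that] unfolding P_def G_def by auto
  have G0: "G 0 = z0" using radial[of 0 0] Q[of 0] unfolding P_def by simp
  have radc: "continuous_on {0..1} (\<lambda>t. G (t *\<^sub>R w))" if w: "w \<in> ball 0 1" for w
  proof -
    have "continuous_on {0..1} (Q w)" using Q[OF w] unfolding P_def by blast
    then show ?thesis by (rule continuous_on_eq) (use radial[OF w] in auto)
  qed
  have radc': "continuous_on {0..m} (\<lambda>t. G (t *\<^sub>R w))" if m: "m > 0" "m *\<^sub>R w \<in> ball 0 1" for w m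
  proof -
    have "continuous_on {0..m} (\<lambda>t. G ((t / m) *\<^sub>R (m *\<^sub>R w)))"
      by (rule continuous_on_compose2[OF radc[OF m(2)]]) (use m(1) in \<open>auto intro!: continuous_intros\<close>)
    then show ?thesis using m(1) by simp
  qed
  have near: "\<exists>e>0. ball x e \<subseteq> ball 0 1 \<and> (\<exists>h. continuous_on (ball x e) h \<and> (\<forall>v\<in>ball x e. f (h v) = \<psi> v) \<and>
       (\<exists>r>0. \<forall>v\<in>ball x e. G v \<in> ball (G x) r \<longrightarrow> h v = G v) \<and> h x = G x)" if x: "x \<in> ball 0 1" for x
  proof -
    have "f (G x) \<notin> singular_values f" using Gf reg x by simp
    then obtain r d h where h: "0 < r" "0 < d" "continuous_on (ball (f (G x)) d) h" "h (f (G x)) = G x"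
      "\<And>w. w \<in> ball (f (G x)) d \<Longrightarrow> f (h w) = w"
      "\<And>y. y \<in> ball (G x) r \<Longrightarrow> f y \<in> ball (f (G x)) d \<Longrightarrow> h (f y) = y"
      using local_inverse_at_regular_value[OF f] by metis
    have "open (ball 0 1 \<inter> \<psi> -` ball (\<psi> x) d)"
      using \<psi> by (intro continuous_open_preimage) auto
    moreover have "x \<in> ball 0 1 \<inter> \<psi> -` ball (\<psi> x) d" using x h(2) by auto
    ultimately obtain e where e: "e > 0" "ball x e \<subseteq> ball 0 1 \<inter> \<psi> -` ball (\<psi> x) d"
      using open_contains_ball by (metis (no_types, lifting))
    have b: "\<psi> v \<in> ball (f (G x)) d" if "v \<in> ball x e" for v using e(2) that Gf[OF x] by auto
    show ?thesis
    proof (rule exI[of _ e], intro conjI e(1) exI[of _ "\<lambda>v. h (\<psi> v)"] ballI exI[of _ r] h(1) impI)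
      show "ball x e \<subseteq> ball 0 1" using e(2) by blast
      show "continuous_on (ball x e) (\<lambda>v. h (\<psi> v))"
        by (rule continuous_on_compose2[OF h(3)])
           (use e(2) b in \<open>auto intro: continuous_on_subset[OF \<psi>]\<close>)
      show "f (h (\<psi> v)) = \<psi> v" if "v \<in> ball x e" for v using h(5) b that by blast
      show "h (\<psi> v) = G v" if "v \<in> ball x e" "G v \<in> ball (G x) r" for v
        using h(6)[OF that(2)] b[OF that(1)] Gf[of v] that(1) e(2) by auto
      show "h (\<psi> x) = G x" using h(4) Gf[OF x] by simp
    qed
  qed
  define good where "good x \<longleftrightarrow> (\<exists>e>0. ball x e \<subseteq> ball 0 1 \<and> continuous_on (ball x e) G)" for x
  have op: "open {x. good x}"
  proof (rule openI)
    fix x assume "x \<in> {x. good x}"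
    then obtain e where e: "e > 0" "ball x e \<subseteq> ball 0 1" "continuous_on (ball x e) G" unfolding good_def by auto
    have "good y" if y: "y \<in> ball x e" for y
    proof -
      obtain e' where e': "e' > 0" "ball y e' \<subseteq> ball x e" using y open_contains_ball open_ball by metis
      then show ?thesis unfolding good_def using e by (meson continuous_on_subset order_trans)
    qed
    then show "\<exists>e>0. ball x e \<subseteq> {x. good x}" using e(1) by auto
  qed
  have g0: "good 0"
  proof -
    obtain e h where e: "e > 0" "ball 0 e \<subseteq> ball (0::complex) 1" "continuous_on (ball 0 e) h"
      "\<And>v. v \<in> ball 0 e \<Longrightarrow> f (h v) = \<psi> v" "h 0 = G 0"
      using near[of 0] by auto
    have "G v = h v" if v: "v \<in> ball 0 e" for v
    proof -
      have tv: "t *\<^sub>R v \<in> ball 0 e" if "t \<in> {0..1}" for t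
        using that v mult_left_le_one_le[of "norm v" t] by (auto simp: mult.commute)
      have "G (1 *\<^sub>R v) = h (1 *\<^sub>R v)"
      proof (rule lift_unique[OF f, of "{0..1::real}" "\<lambda>t. G (t *\<^sub>R v)" "\<lambda>t. h (t *\<^sub>R v)" 0])
        show "continuous_on {0..1} (\<lambda>t. G (t *\<^sub>R v))" using radc v e(2) by blast
        show "continuous_on {0..1} (\<lambda>t. h (t *\<^sub>R v))"
          by (rule continuous_on_compose2[OF e(3)]) (use tv in \<open>auto intro!: continuous_intros\<close>)
        show "f (G (t *\<^sub>R v)) = f (h (t *\<^sub>R v))" "f (G (t *\<^sub>R v)) \<notin> singular_values f" if "t \<in> {0..1}" for t
        proof -
          have "t *\<^sub>R v \<in> ball 0 1" using tv[OF that] e(2) by blast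
          then show "f (G (t *\<^sub>R v)) = f (h (t *\<^sub>R v))" "f (G (t *\<^sub>R v)) \<notin> singular_values f"
            using tv[OF that] e(4) Gf reg by auto
        qed
        show "G (0 *\<^sub>R v) = h (0 *\<^sub>R v)" using e(5) by simp
      qed auto
      then show ?thesis by simp
    qed
    then have "continuous_on (ball 0 e) G" using e(3) by (metis (no_types, lifting) continuous_on_cong)
    then show ?thesis unfolding good_def using e(1,2) by blast
  qed
  \<comment> \<open>The local lift \<open>h\<close> near \<open>x\<close> is known to agree with
    \<open>G\<close> only where \<open>G\<close> is close to \<open>G x\<close>. Continuity along
    the radius provides this at a good point \<open>y\<close> of the radius near \<open>x\<close>.
    Uniqueness extends the agreement to a ball around \<open>y\<close>, and then along radial
    segments to a ball around \<open>x\<close>.\<close>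
  have step: "good (t *\<^sub>R w)" if w: "w \<in> ball 0 1" and t: "0 < t" "t \<le> 1"
    and acc: "\<And>\<epsilon>. \<epsilon> > 0 \<Longrightarrow> \<exists>t'\<in>{0..1}. 0 < t' \<and> \<bar>t' - t\<bar> < \<epsilon> \<and> good (t' *\<^sub>R w)" for w t
  proof -
    define x where "x = t *\<^sub>R w"
    have x: "x \<in> ball 0 1" using scale w t unfolding x_def by auto
    obtain e h r where e: "e > 0" "ball x e \<subseteq> ball 0 1" "continuous_on (ball x e) h"
      "\<And>v. v \<in> ball x e \<Longrightarrow> f (h v) = \<psi> v" and r: "r > 0" 
      "\<And>v. v \<in> ball x e \<Longrightarrow> G v \<in> ball (G x) r \<Longrightarrow> h v = G v"
      using near[OF x] by blast
    have "continuous_on {0..1} (\<lambda>t. t *\<^sub>R w)" by (intro continuous_intros)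
    then obtain e1 where e1: "e1 > 0" "\<And>t'. t' \<in> {0..1} \<Longrightarrow> \<bar>t' - t\<bar> < e1 \<Longrightarrow> dist (t' *\<^sub>R w) x < e"
      using t e(1) unfolding continuous_on_iff x_def dist_real_def by (metis atLeastAtMost_iff less_imp_le)
    obtain e2 where e2: "e2 > 0" "\<And>t'. t' \<in> {0..1} \<Longrightarrow> \<bar>t' - t\<bar> < e2 \<Longrightarrow> dist (G (t' *\<^sub>R w)) (G x) < r"
      using t r(1) radc[OF w] unfolding continuous_on_iff x_def dist_real_def by (metis atLeastAtMost_iff less_imp_le)
    obtain t' where t': "t' \<in> {0..1}" "0 < t'" "\<bar>t' - t\<bar> < min e1 e2" "good (t' *\<^sub>R w)"
      using acc[of "min e1 e2"] e1 e2 by auto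
    define y where "y = t' *\<^sub>R w"
    have yx: "y \<in> ball x e" using e1(2)[OF t'(1)] t'(3) unfolding y_def by (simp add: dist_commute)
    have Gy: "h y = G y" 
      using r(2)[OF yx] e2(2)[OF t'(1)] t'(3) unfolding y_def by (simp add: dist_commute)
    obtain e3 where e3: "e3 > 0" "ball y e3 \<subseteq> ball 0 1" "continuous_on (ball y e3) G"
      using t'(4) unfolding good_def y_def by blast
    obtain e4 where e4: "e4 > 0" "ball y e4 \<subseteq> ball x e" using yx open_contains_ball open_ball by metis
    define e5 where "e5 = min e3 e4"
    have e5: "e5 > 0" "ball y e5 \<subseteq> ball y e3" "ball y e5 \<subseteq> ball x e" "ball y e5 \<subseteq> ball 0 1"
      using e3 e4 unfolding e5_def by auto
    have Gh: "G v = h v" if "v \<in> ball y e5" for v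
    proof (rule lift_unique[OF f, of "ball y e5" G h y])
      show "continuous_on (ball y e5) G" "continuous_on (ball y e5) h"
        using e3(3) e(3) e5 continuous_on_subset by blast+
      show "f (G v) = f (h v)" "f (G v) \<notin> singular_values f" if "v \<in> ball y e5" for v
      proof -
        have "v \<in> ball x e" "v \<in> ball 0 1" using that e5 by blast+
        then show "f (G v) = f (h v)" "f (G v) \<notin> singular_values f" using Gf e(4) reg by auto
      qed
    qed (use Gy e5 that in auto)
    \<comment> \<open>Scaling by \<open>a\<close> takes \<open>x\<close> to \<open>y\<close>, and so
      a small ball around \<open>x\<close> into the ball around \<open>y\<close> where
      \<open>G\<close> and \<open>h\<close> agree. The radial segment from
      \<open>a *\<^sub>R v\<close> to \<open>v\<close> stays in the convex ball on which
      \<open>h\<close> is defined. Both \<open>a \<le> 1\<close> and \<open>a > 1\<close> occur,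
      hence \<open>min\<close> and \<open>max\<close>.\<close>
    define a where "a = t' / t"
    have a: "a > 0" "a *\<^sub>R x = y" using t t' unfolding a_def x_def y_def by auto
    have "G v = h v" if v: "v \<in> ball x (min e (e5 / a))" for v
    proof -
      have av: "a *\<^sub>R v \<in> ball y e5"
      proof -
        have "dist y (a *\<^sub>R v) = a * dist x v" unfolding a(2)[symmetric] by (simp add: dist_norm a(1) less_imp_le flip: scaleR_diff_right)
        also have "\<dots> < a * (e5 / a)" using v a(1) by (intro mult_strict_left_mono) auto
        finally show ?thesis using a(1) by simp
      qed
      define m where "m = max a 1"
      have m: "m > 0" "m *\<^sub>R v \<in> ball 0 1"
        using av e5(4) v e(2) unfolding m_def max_def by (auto split: if_splits)
      have seg: "\<sigma> *\<^sub>R v \<in> ball x e" if "\<sigma> \<in> {min a 1..max a 1}" for \<sigma>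
      proof -
        have "a *\<^sub>R v \<in> ball x e" "1 *\<^sub>R v \<in> ball x e" using av e5 v by auto
        then have "closed_segment (a *\<^sub>R v) (1 *\<^sub>R v) \<subseteq> ball x e" by (meson closed_segment_subset convex_ball)
        moreover have "\<sigma> \<in> closed_segment a 1" using that by (simp add: closed_segment_eq_real_ivl min_def max_def split: if_splits)
        then obtain u where u: "0 \<le> u" "u \<le> 1" "\<sigma> = (1 - u) *\<^sub>R a + u *\<^sub>R 1"
          unfolding closed_segment_def by blast
        have "\<sigma> *\<^sub>R v = (1 - u) *\<^sub>R (a *\<^sub>R v) + u *\<^sub>R (1 *\<^sub>R v)"
          unfolding u(3) by (simp add: scaleR_add_left)
        then have "\<sigma> *\<^sub>R v \<in> closed_segment (a *\<^sub>R v) (1 *\<^sub>R v)"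
          unfolding closed_segment_def using u(1,2) by blast
        ultimately show ?thesis by blast
      qed
      have "G (1 *\<^sub>R v) = h (1 *\<^sub>R v)"
      proof (rule lift_unique[OF f, of "{min a 1..max a 1}" "\<lambda>t. G (t *\<^sub>R v)" "\<lambda>t. h (t *\<^sub>R v)" a])
        show "continuous_on {min a 1..max a 1} (\<lambda>t. G (t *\<^sub>R v))"
          by (rule continuous_on_subset[OF radc'[OF m]]) (use a(1) in \<open>auto simp: m_def\<close>)
        show "continuous_on {min a 1..max a 1} (\<lambda>t. h (t *\<^sub>R v))"
          by (rule continuous_on_compose2[OF e(3)]) (use seg in \<open>auto intro!: continuous_intros\<close>)
        show "f (G (\<sigma> *\<^sub>R v)) = f (h (\<sigma> *\<^sub>R v))" "f (G (\<sigma> *\<^sub>R v)) \<notin> singular_values f"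
          if "\<sigma> \<in> {min a 1..max a 1}" for \<sigma>
        proof -
          have "\<sigma> *\<^sub>R v \<in> ball 0 1" using seg[OF that] e(2) by blast
          then show "f (G (\<sigma> *\<^sub>R v)) = f (h (\<sigma> *\<^sub>R v))" "f (G (\<sigma> *\<^sub>R v)) \<notin> singular_values f"
            using seg[OF that] e(4) Gf reg by auto
        qed
        show "G (a *\<^sub>R v) = h (a *\<^sub>R v)" using Gh av by blast
      qed auto
      then show ?thesis by simp
    qed
    then have "continuous_on (ball x (min e (e5 / a))) G"
      using continuous_on_subset[OF e(3), of "ball x (min e (e5 / a))"]
      by (metis (no_types, lifting) continuous_on_cong min.cobounded1 subset_ball)
    moreover have "min e (e5 / a) > 0" using e(1) e5(1) a(1) by auto
    moreover have "ball x (min e (e5 / a)) \<subseteq> ball 0 1" using e(2) by (meson min.cobounded1 order_trans subset_ball)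
    ultimately show ?thesis unfolding good_def x_def by blast
  qed
  have all: "good w" if w: "w \<in> ball 0 1" for w
  proof -
    define T where "T = {t\<in>{0..1}. good (t *\<^sub>R w)}"
    have Teq: "T = {0..1} \<inter> (\<lambda>t. t *\<^sub>R w) -` {x. good x}" unfolding T_def by auto
    have opT: "openin (top_of_set {0..1}) T" unfolding Teq
      by (intro continuous_openin_preimage_gen op continuous_intros)
    have T0: "0 \<in> T" unfolding T_def using g0 by simp
    have "closedin (top_of_set {0..1}) T"
      unfolding closedin_limpt
    proof (intro conjI allI impI)
      show "T \<subseteq> {0..1}" unfolding T_def by blast
      fix t assume t: "t islimpt T \<and> t \<in> {0..1}"
      show "t \<in> T"
      proof (cases "t = 0")
        case False
        then have t': "0 < t" "t \<le> 1" using t by auto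
        have "good (t *\<^sub>R w)"
        proof (rule step[OF w t'])
          fix \<epsilon> :: real assume "\<epsilon> > 0"
          then obtain t1 where "t1 \<in> T" "dist t1 t < min \<epsilon> t"
            using t t' unfolding islimpt_approachable by (metis min_less_iff_conj)
          then show "\<exists>t'\<in>{0..1}. 0 < t' \<and> \<bar>t' - t\<bar> < \<epsilon> \<and> good (t' *\<^sub>R w)"
            unfolding T_def dist_real_def by (intro bexI[of _ t1]) auto
        qed
        then show ?thesis unfolding T_def using t' by auto
      qed (use T0 in simp)
    qed
    then have "T = {0..1}" using opT T0 connected_clopen[of "{0..1::real}"] by auto
    then have "1 \<in> T" by simp
    then show ?thesis unfolding T_def by simp
  qed
  have "continuous_on (ball 0 1) G"
  proof (rule continuous_at_imp_continuous_on, intro ballI)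
    fix w :: complex assume "w \<in> ball 0 1"
    then obtain e where "e > 0" "continuous_on (ball w e) G" using all unfolding good_def by blast
    then show "isCont G w" by (simp add: continuous_on_eq_continuous_at)
  qed
  then show ?thesis using that G0 Gf by blast
qed

text \<open>A homeomorphism with the disk reduces this to \<open>lift_ball\<close>, which prescribes
  the value at the centre. The prescribed value at \<open>w1\<close> is first moved to the centre by
  lifting the radius backwards.\<close>

lemma lift_simply_connected:
  fixes \<psi> :: "complex \<Rightarrow> complex"
  assumes f: "f holomorphic_on UNIV" and D: "open D" "simply_connected D"
    and \<psi>: "continuous_on D \<psi>" and reg: "\<And>w. w \<in> D \<Longrightarrow> \<psi> w \<notin> singular_values f"
    and w1: "w1 \<in> D" "f z1 = \<psi> w1"
  obtains G where "continuous_on D G" "G w1 = z1" "\<And>w. w \<in> D \<Longrightarrow> f (G w) = \<psi> w"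
proof -
  have "D homeomorphic ball (0::complex) 1"
    using D w1 simply_connected_eq_homeomorphic_to_disc by blast
  then obtain \<beta> \<alpha> where "homeomorphism D (ball (0::complex) 1) \<beta> \<alpha>" unfolding homeomorphic_def by blast
  then have \<alpha>: "continuous_on (ball 0 1) \<alpha>" "\<And>x. x \<in> ball 0 1 \<Longrightarrow> \<alpha> x \<in> D"
    and \<beta>: "continuous_on D \<beta>" "\<And>w. w \<in> D \<Longrightarrow> \<beta> w \<in> ball 0 1" "\<And>w. w \<in> D \<Longrightarrow> \<alpha> (\<beta> w) = w"
    unfolding homeomorphism_def by blast+
  define b where "b = \<beta> w1"
  have b: "b \<in> ball 0 1" "\<alpha> b = w1" using \<beta> w1 unfolding b_def by auto
  have sc: "t *\<^sub>R b \<in> ball 0 1" if "t \<in> {0..1}" for t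
    using that b(1) mult_left_le_one_le[of "norm b" t] by (auto simp: mult.commute)
  have c\<psi>\<alpha>: "continuous_on (ball 0 1) (\<lambda>x. \<psi> (\<alpha> x))"
    by (rule continuous_on_compose2[OF \<psi> \<alpha>(1)]) (use \<alpha>(2) in auto)
  have c: "continuous_on {0..1} (\<lambda>t. \<psi> (\<alpha> ((1 - t) *\<^sub>R b)))"
    by (rule continuous_on_compose2[OF c\<psi>\<alpha>]) (use sc in \<open>auto intro!: continuous_intros\<close>)
  have regb: "\<psi> (\<alpha> x) \<notin> singular_values f" if "x \<in> ball 0 1" for x using reg \<alpha>(2) that by blast
  obtain q where q: "continuous_on {0..1} q" "q 0 = z1" "\<And>t. t \<in> {0..1} \<Longrightarrow> f (q t) = \<psi> (\<alpha> ((1 - t) *\<^sub>R b))"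
    by (rule lift_path[OF f c, of z1]) (use sc regb w1(2) b(2) in auto)
  have "f (q 1) = \<psi> (\<alpha> 0)" using q(3)[of 1] by simp
  then obtain G where G: "continuous_on (ball 0 1) G" "G 0 = q 1" "\<And>x. x \<in> ball 0 1 \<Longrightarrow> f (G x) = \<psi> (\<alpha> x)"
    using lift_ball[OF f c\<psi>\<alpha> regb, of "q 1"] by metis
  have "G ((1 - 0) *\<^sub>R b) = q 0"
  proof (rule lift_unique[OF f, of "{0..1::real}" "\<lambda>t. G ((1 - t) *\<^sub>R b)" q 1])
    show "continuous_on {0..1} (\<lambda>t. G ((1 - t) *\<^sub>R b))"
      by (rule continuous_on_compose2[OF G(1)]) (use sc in \<open>auto intro!: continuous_intros\<close>)
    show "f (G ((1 - t) *\<^sub>R b)) = f (q t)" "f (G ((1 - t) *\<^sub>R b)) \<notin> singular_values f" if "t \<in> {0..1}" for t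
      using q(3)[OF that] G(3) regb sc[of "1 - t"] that by auto
  qed (use G(2) q(1) in auto)
  then have "G b = z1" using q(2) by simp
  show ?thesis
  proof (rule that[of "\<lambda>w. G (\<beta> w)"])
    show "continuous_on D (\<lambda>w. G (\<beta> w))"
      by (rule continuous_on_compose2[OF G(1) \<beta>(1)]) (use \<beta>(2) in auto)
    show "G (\<beta> w1) = z1" using \<open>G b = z1\<close> b_def by simp
    show "f (G (\<beta> w)) = \<psi> w" if "w \<in> D" for w using G(3) \<beta> that by simp
  qed
qed

section \<open>Iterates near the Julia set\<close>

text \<open>After normalization the omitted values are 0 and 1. If infinitely many functions have
  modulus at most 1 at \<open>w\<close>, the Schottky-type bound \<open>GPicard3\<close> makes them
  locally bounded. Otherwise the reciprocals are eventually bounded by 1 at \<open>w\<close>, and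
  they omit 0 and 1 as well. By Hurwitz the limit of the reciprocals has no zero, which gives a
  holomorphic limit, or vanishes identically, which is uniform divergence to infinity on compact
  sets.\<close>

lemma montel_two_omitted_values:
  fixes F :: "nat \<Rightarrow> complex \<Rightarrow> complex"
  assumes D: "open D" "connected D" and hol: "\<And>n. F n holomorphic_on D"
    and ab: "a \<noteq> b" and om: "\<And>n z. z \<in> D \<Longrightarrow> F n z \<noteq> a \<and> F n z \<noteq> b"
  shows "\<exists>r :: nat \<Rightarrow> nat. strict_mono r \<and>
           ((\<exists>g. g holomorphic_on D \<and>
                (\<forall>K. compact K \<and> K \<subseteq> D \<longrightarrow> uniform_limit K (\<lambda>n. F (r n)) g sequentially)) \<or>
            (\<forall>K. compact K \<and> K \<subseteq> D \<longrightarrow>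
                (\<forall>B. \<forall>\<^sub>F n in sequentially. \<forall>z\<in>K. norm (F (r n) z) \<ge> B)))"
proof (cases "D = {}")
  case True
  then have "strict_mono (id :: nat \<Rightarrow> nat)" "(\<lambda>_. 0) holomorphic_on D" by (auto simp: strict_mono_def)
  then show ?thesis using True by (intro exI[of _ id]) auto
next
  case False
  then obtain w where w: "w \<in> D" by blast
  define H where "H n z = (F n z - a) / (b - a)" for n z
  have Hhol: "H n holomorphic_on D" for n
    unfolding H_def using ab by (intro holomorphic_intros hol) auto
  have H01: "H n z \<noteq> 0 \<and> H n z \<noteq> 1" if "z \<in> D" for n z
    using om[OF that, of n] ab unfolding H_def by auto
  have FH: "F n z = a + (b - a) * H n z" for n z using ab unfolding H_def by simp
  have sub: "\<exists>g r. g holomorphic_on D \<and> strict_mono (r :: nat \<Rightarrow> nat) \<and>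
      (\<forall>K. compact K \<and> K \<subseteq> D \<longrightarrow> uniform_limit K (\<lambda>n. G (r n)) g sequentially)"
    if G: "\<And>n. G n holomorphic_on D" "\<And>n z. z \<in> D \<Longrightarrow> G n z \<noteq> 0 \<and> G n z \<noteq> 1"
      "\<And>n. norm (G n w) \<le> 1" for G :: "nat \<Rightarrow> complex \<Rightarrow> complex"
  proof -
    have bd: "\<exists>B. \<forall>h\<in>range G. \<forall>z\<in>K. norm (h z) \<le> B" if K: "compact K" "K \<subseteq> D" for K
      using GPicard3[OF D w subset_refl[of "range G"] _ _ _ K] G by (metis (no_types, lifting) imageE)
    obtain g r where "g holomorphic_on D" "strict_mono (r :: nat \<Rightarrow> nat)"
      "\<And>K. \<lbrakk>compact K; K \<subseteq> D\<rbrakk> \<Longrightarrow> uniform_limit K (G \<circ> r) g sequentially"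
      by (rule Montel[OF D(1), of "range G" G]) (use G(1) bd in auto)
    then show ?thesis unfolding comp_def by blast
  qed
  show ?thesis
  proof (cases "infinite {n. norm (H n w) \<le> 1}")
    case True
    then obtain \<sigma> where \<sigma>: "strict_mono (\<sigma> :: nat \<Rightarrow> nat)" "\<And>n. norm (H (\<sigma> n) w) \<le> 1"
      using infinite_enumerate[OF True] by auto
    obtain g r where g: "g holomorphic_on D" "strict_mono (r :: nat \<Rightarrow> nat)"
      "\<And>K. compact K \<and> K \<subseteq> D \<Longrightarrow> uniform_limit K (\<lambda>n. H (\<sigma> (r n))) g sequentially"
      using sub[of "\<lambda>n. H (\<sigma> n)"] Hhol H01 \<sigma>(2) by blast
    have "uniform_limit K (\<lambda>n. F ((\<sigma> \<circ> r) n)) (\<lambda>z. a + (b - a) * g z) sequentially"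
      if "compact K \<and> K \<subseteq> D" for K
    proof -
      have "uniform_limit K (\<lambda>n z. (b - a) * H (\<sigma> (r n)) z) (\<lambda>z. (b - a) * g z) sequentially"
        using g(3)[OF that] by (intro bounded_linear.uniform_limit[OF bounded_linear_mult_right])
      then have "uniform_limit K (\<lambda>n z. a + (b - a) * H (\<sigma> (r n)) z) (\<lambda>z. a + (b - a) * g z) sequentially"
        by (intro uniform_limit_add uniform_limit_const)
      then show ?thesis by (simp add: FH[abs_def] comp_def)
    qed
    moreover have "(\<lambda>z. a + (b - a) * g z) holomorphic_on D" by (intro holomorphic_intros g(1))
    ultimately show ?thesis using strict_mono_o[OF \<sigma>(1) g(2)] by blast
  next
    case False
    then obtain M where M: "\<And>n. M \<le> n \<Longrightarrow> \<not> norm (H n w) \<le> 1"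
      using infinite_nat_iff_unbounded_le[of "{n. norm (H n w) \<le> 1}"] by auto
    define \<sigma> where "\<sigma> n = M + n" for n
    have \<sigma>: "strict_mono \<sigma>" unfolding \<sigma>_def strict_mono_def by simp
    define G where "G n z = inverse (H (\<sigma> n) z)" for n z
    have G1: "G n holomorphic_on D" for n unfolding G_def using Hhol H01 by (intro holomorphic_intros) auto
    have G2: "G n z \<noteq> 0 \<and> G n z \<noteq> 1" if "z \<in> D" for n z
      using H01[OF that, of "\<sigma> n"] unfolding G_def by (auto simp: inverse_eq_1_iff)
    have G3: "norm (G n w) \<le> 1" for n
      using M[of "\<sigma> n"] unfolding G_def \<sigma>_def by (simp add: norm_inverse inverse_le_1_iff)
    obtain g r where g: "g holomorphic_on D" "strict_mono (r :: nat \<Rightarrow> nat)"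
      "\<And>K. compact K \<and> K \<subseteq> D \<Longrightarrow> uniform_limit K (\<lambda>n. G (r n)) g sequentially"
      using sub[of G] G1 G2 G3 by blast
    have HG: "H (\<sigma> n) z = inverse (G n z)" for n z unfolding G_def by simp
    show ?thesis
    proof (cases "\<exists>z0\<in>D. g z0 = 0")
      case True
      then obtain z0 where z0: "z0 \<in> D" "g z0 = 0" by blast
      have "g constant_on D"
        using Hurwitz_no_zeros[OF D, of "\<lambda>n. G (r n)" g z0] G1 G2 g z0 by blast
      then have g0: "g z = 0" if "z \<in> D" for z using z0 that unfolding constant_on_def by metis
      have "\<forall>\<^sub>F n in sequentially. \<forall>z\<in>K. norm (F ((\<sigma> \<circ> r) n) z) \<ge> B" if K: "compact K \<and> K \<subseteq> D" for K B
      proof -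
        define C where "C = (\<bar>B\<bar> + norm a) / norm (b - a) + 1"
        have C: "C > 0" unfolding C_def by (intro add_nonneg_pos) auto
        have "\<forall>\<^sub>F n in sequentially. \<forall>z\<in>K. dist (G (r n) z) (g z) < inverse C"
          using g(3)[OF K] C unfolding uniform_limit_iff by simp
        then show ?thesis
        proof eventually_elim
          case (elim n)
          show ?case
          proof
            fix z assume z: "z \<in> K"
            then have zD: "z \<in> D" using K by blast
            have "norm (G (r n) z) < inverse C" using elim z g0[OF zD] by (metis dist_0_norm dist_commute)
            moreover have "0 < norm (G (r n) z)" using G2[OF zD] by simp
            ultimately have "C < norm (H (\<sigma> (r n)) z)"
              using C unfolding HG norm_inverse by (metis inverse_inverse_eq less_imp_inverse_less)
            then have "norm (b - a) * C < norm (b - a) * norm (H (\<sigma> (r n)) z)" using ab by simp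
            moreover have "norm (b - a) * C = \<bar>B\<bar> + norm a + norm (b - a)"
              unfolding C_def using ab by (simp add: field_simps)
            ultimately have "\<bar>B\<bar> + norm a < norm ((b - a) * H (\<sigma> (r n)) z)"
              unfolding norm_mult using norm_ge_zero[of "b - a"] by linarith
            moreover have "norm ((b - a) * H (\<sigma> (r n)) z) - norm a \<le> norm (F (\<sigma> (r n)) z)"
              unfolding FH using norm_diff_ineq[of "(b - a) * H (\<sigma> (r n)) z" a] by (simp add: add.commute)
            ultimately show "B \<le> norm (F ((\<sigma> \<circ> r) n) z)" by simp
          qed
        qed
      qed
      then show ?thesis using strict_mono_o[OF \<sigma> g(2)] by blast
    next
      case False
      then have gn: "\<And>z. z \<in> D \<Longrightarrow> g z \<noteq> 0" by blast
      have "uniform_limit K (\<lambda>n. F ((\<sigma> \<circ> r) n)) (\<lambda>z. a + (b - a) * inverse (g z)) sequentially"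
        if K: "compact K \<and> K \<subseteq> D" for K
      proof -
        have cg: "continuous_on K g" using g(1) K holomorphic_on_imp_continuous_on continuous_on_subset by blast
        have "\<exists>m>0. \<forall>z\<in>K. m \<le> norm (g z)"
        proof (cases "K = {}")
          case True then show ?thesis by (intro exI[of _ 1]) auto
        next
          case False
          have "continuous_on K (\<lambda>z. norm (g z))" using cg by (intro continuous_intros)
          then obtain z where z: "z \<in> K" "\<forall>y\<in>K. norm (g z) \<le> norm (g y)"
            using continuous_attains_inf[of K "\<lambda>z. norm (g z)"] K False by blast
          then show ?thesis using gn K by (intro exI[of _ "norm (g z)"]) auto
        qed
        then obtain m where m: "m > 0" "\<And>z. z \<in> K \<Longrightarrow> m \<le> norm (g z)" by blast
        have "uniform_limit K (\<lambda>n z. inverse (G (r n) z)) (\<lambda>z. inverse (g z)) sequentially"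
          using uniform_lim_inverse[OF g(3)[OF K] m(2) m(1)] by (simp add: comp_def)
        then have "uniform_limit K (\<lambda>n z. (b - a) * H (\<sigma> (r n)) z) (\<lambda>z. (b - a) * inverse (g z)) sequentially"
          unfolding HG by (intro bounded_linear.uniform_limit[OF bounded_linear_mult_right])
        then have "uniform_limit K (\<lambda>n z. a + (b - a) * H (\<sigma> (r n)) z) (\<lambda>z. a + (b - a) * inverse (g z)) sequentially"
          by (intro uniform_limit_add uniform_limit_const)
        then show ?thesis by (simp add: FH[abs_def] comp_def)
      qed
      moreover have "(\<lambda>z. a + (b - a) * inverse (g z)) holomorphic_on D" using gn by (intro holomorphic_intros g(1)) auto
      ultimately show ?thesis using strict_mono_o[OF \<sigma> g(2)] by blast
    qed
  qed
qed

lemma holomorphic_on_funpow: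
  assumes "f holomorphic_on UNIV"
  shows "(f ^^ n) holomorphic_on UNIV"
proof (induction n)
  case 0
  show ?case by (simp add: id_def)
next
  case (Suc n)
  then show ?case using holomorphic_on_compose[OF Suc.IH, of f] holomorphic_on_subset[OF assms] by (simp add: comp_def)
qed

text \<open>One \<open>N\<close> has to serve for all \<open>i\<close>. If there were none, every
  iterate would miss some \<open>X i\<close> on \<open>D\<close>; by pigeonhole any sequence of
  iterates would contain a subsequence missing the same \<open>X i\<close>, and so two fixed values.
  By Montel the iterates would be normal on \<open>D\<close>.\<close>

lemma iterated_images_of_Julia_neighbourhood:
  assumes f: "f holomorphic_on UNIV" and s: "s \<in> Julia_set f"
    and D: "open D" "connected D" "s \<in> D" and I: "finite I"
    and ab: "\<And>i. i \<in> I \<Longrightarrow> a i \<in> X i \<and> b i \<in> X i \<and> a i \<noteq> b i"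
  shows "\<exists>N. \<forall>i\<in>I. (f ^^ N) ` D \<inter> X i \<noteq> {}"
proof (rule ccontr)
  assume "\<not> ?thesis"
  then have "\<exists>i. i \<in> I \<and> (f ^^ N) ` D \<inter> X i = {}" for N by blast
  then obtain \<iota> where \<iota>: "\<And>N. \<iota> N \<in> I" "\<And>N. (f ^^ N) ` D \<inter> X (\<iota> N) = {}" by metis
  have "normal_family_on (range (\<lambda>n. f ^^ n)) D"
    unfolding normal_family_on_def
  proof (intro allI impI)
    fix F :: "nat \<Rightarrow> complex \<Rightarrow> complex" assume F: "range F \<subseteq> range (\<lambda>n. f ^^ n)"
    then have "\<exists>k. F n = f ^^ k" for n by blast
    then obtain k where k: "\<And>n. F n = f ^^ k n" by metis
    have "\<exists>i\<in>I. infinite {n \<in> UNIV. \<iota> (k n) = i}"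
      by (rule pigeonhole_infinite_rel) (use I \<iota>(1) in auto)
    then obtain i where i: "i \<in> I" "infinite {n. \<iota> (k n) = i}" by auto
    obtain \<sigma> where \<sigma>: "strict_mono (\<sigma> :: nat \<Rightarrow> nat)" "\<And>n. \<iota> (k (\<sigma> n)) = i"
      using infinite_enumerate[OF i(2)] by auto
    have "\<exists>r :: nat \<Rightarrow> nat. strict_mono r \<and>
           ((\<exists>g. g holomorphic_on D \<and>
                (\<forall>K. compact K \<and> K \<subseteq> D \<longrightarrow> uniform_limit K (\<lambda>n. F (\<sigma> (r n))) g sequentially)) \<or>
            (\<forall>K. compact K \<and> K \<subseteq> D \<longrightarrow>
                (\<forall>B. \<forall>\<^sub>F n in sequentially. \<forall>z\<in>K. norm (F (\<sigma> (r n)) z) \<ge> B)))"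
    proof (rule montel_two_omitted_values[OF D(1,2)])
      show "F (\<sigma> n) holomorphic_on D" for n
        unfolding k using holomorphic_on_funpow[OF f] holomorphic_on_subset by blast
      show "a i \<noteq> b i" using ab i by blast
      show "F (\<sigma> n) z \<noteq> a i \<and> F (\<sigma> n) z \<noteq> b i" if "z \<in> D" for n z
      proof -
        have "(f ^^ k (\<sigma> n)) z \<notin> X i" using \<iota>(2)[of "k (\<sigma> n)"] \<sigma>(2)[of n] that by auto
        then show ?thesis using ab[OF i(1)] unfolding k by metis
      qed
    qed
    then obtain r :: "nat \<Rightarrow> nat" where r: "strict_mono r"
      "(\<exists>g. g holomorphic_on D \<and>
                (\<forall>K. compact K \<and> K \<subseteq> D \<longrightarrow> uniform_limit K (\<lambda>n. F ((\<sigma> \<circ> r) n)) g sequentially)) \<or>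
            (\<forall>K. compact K \<and> K \<subseteq> D \<longrightarrow>
                (\<forall>B. \<forall>\<^sub>F n in sequentially. \<forall>z\<in>K. norm (F ((\<sigma> \<circ> r) n) z) \<ge> B))"
      unfolding comp_def by blast
    then show "\<exists>r :: nat \<Rightarrow> nat. strict_mono r \<and>
           ((\<exists>g. g holomorphic_on D \<and>
                (\<forall>K. compact K \<and> K \<subseteq> D \<longrightarrow> uniform_limit K (\<lambda>n. F (r n)) g sequentially)) \<or>
            (\<forall>K. compact K \<and> K \<subseteq> D \<longrightarrow>
                (\<forall>B. \<forall>\<^sub>F n in sequentially. \<forall>z\<in>K. norm (F (r n) z) \<ge> B)))"
      using strict_mono_o[OF \<sigma>(1) r(1)] by blast
  qed
  then have "s \<in> Fatou_set f" unfolding Fatou_set_def using D by blast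
  then show False using s unfolding Julia_set_def by blast
qed

section \<open>Logarithmic tracts\<close>

lemma transcendental_entire_not_constant:
  assumes "transcendental_entire f"
  shows "\<not> f constant_on UNIV"
proof
  assume "f constant_on UNIV"
  then obtain c where "\<And>z. f z = c" unfolding constant_on_def by auto
  then have "\<forall>z. f z = poly [:c:] z" by simp
  then show False using assms unfolding transcendental_entire_def by blast
qed

lemma transcendental_entire_not_proper:
  assumes f: "transcendental_entire f"
  shows "\<not> filterlim f at_infinity at_infinity"
proof
  assume "filterlim f at_infinity at_infinity"
  then have "((inverse \<circ> f) \<longlongrightarrow> 0) at_infinity"
    unfolding comp_def using tendsto_inverse_0 filterlim_compose by blast
  then obtain a n where a: "\<And>z. f z = (\<Sum>i\<le>n. a i * z ^ i)"
    using pole_at_infinity f unfolding transcendental_entire_def by metis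
  have "\<forall>z. f z = poly (\<Sum>i\<le>n. monom (a i) i) z" by (simp add: a poly_sum poly_monom)
  then show False using f unfolding transcendental_entire_def by blast
qed

text \<open>\<open>k\<close> is only continuous, so invariance of domain replaces the open mapping
  theorem. Local injectivity is inherited from \<open>exp\<close>: two points of a ball of radius at
  most 1 have imaginary parts that differ by less than 2 pi.\<close>

lemma open_image_lift_of_exp:
  fixes k :: "complex \<Rightarrow> complex"
  assumes V: "open V" and k: "continuous_on V k" and exp: "\<And>w. w \<in> V \<Longrightarrow> f (k w) = exp w"
  shows "open (k ` V)"
proof (rule openI)
  fix z assume "z \<in> k ` V"
  then obtain w where w: "w \<in> V" "z = k w" by blast
  obtain e where e: "e > 0" "ball w e \<subseteq> V" using V w(1) open_contains_ball by metis
  define B where "B = ball w (min e 1)"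
  have BV: "B \<subseteq> V" "w \<in> B" unfolding B_def using e by auto
  have "inj_on k B"
  proof (rule inj_onI)
    fix x y assume xy: "x \<in> B" "y \<in> B" "k x = k y"
    then have "exp x = exp y" using exp BV(1) by (metis subsetD)
    moreover have "\<bar>Im x - Im y\<bar> < 2 * pi"
    proof -
      have "dist x y < 2" using xy(1,2) dist_triangle_less_add[of x w 1 y 1] unfolding B_def
        by (auto simp: dist_commute)
      moreover have "\<bar>Im x - Im y\<bar> \<le> dist x y" using abs_Im_le_cmod[of "x - y"] by (simp add: dist_norm)
      ultimately show ?thesis using pi_gt3 by linarith
    qed
    ultimately show "x = y" by (metis exp_complex_eqI)
  qed
  then have "open (k ` B)"
    using k BV(1) continuous_on_subset unfolding B_def by (intro invariance_of_domain) auto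
  moreover have "z \<in> k ` B" "k ` B \<subseteq> k ` V" using BV w(2) by auto
  ultimately show "\<exists>e>0. ball z e \<subseteq> k ` V" by (meson open_contains_ball order_trans)
qed

text \<open>If the lift \<open>k\<close> of \<open>exp\<close> were periodic, its image would contain a punctured neighbourhood of
  infinity, and \<open>f\<close> would have a pole there.\<close>

lemma lift_of_exp_not_periodic:
  fixes k :: "complex \<Rightarrow> complex" and Y :: real
  assumes f: "transcendental_entire f" and R: "0 < R"
    and k: "continuous_on {w. ln R < Re w} k" and fk: "\<And>w. ln R < Re w \<Longrightarrow> f (k w) = exp w"
    and Y: "0 < Y" and per: "\<And>w. ln R < Re w \<Longrightarrow> k (w + \<i> * of_real Y) = k w"
  shows False
proof -
  have holf: "f holomorphic_on UNIV" using f unfolding transcendental_entire_def by blast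
  then have contf: "continuous_on A f" for A
    using holomorphic_on_imp_continuous_on continuous_on_subset by blast
  have pern: "k (w + \<i> * of_real (real n * Y)) = k w" if w: "ln R < Re w" for w n
  proof (induction n)
    case (Suc n)
    have "k (w + \<i> * of_real (real (Suc n) * Y)) = k ((w + \<i> * of_real (real n * Y)) + \<i> * of_real Y)"
      by (simp add: algebra_simps)
    also have "\<dots> = k (w + \<i> * of_real (real n * Y))" using w by (intro per) simp
    finally show ?case using Suc by simp
  qed simp
  \<comment> \<open>A period in the imaginary direction makes a strip of height \<open>Y\<close>
    carry all values of \<open>k\<close>; with bounded real part it is a compact rectangle.\<close>
  have red: "\<exists>w'. Re w' = Re w \<and> 0 \<le> Im w' \<and> Im w' \<le> Y \<and> k w' = k w" if w: "ln R < Re w" for w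
  proof -
    define m where "m = \<lfloor>Im w / Y\<rfloor>"
    define w' where "w' = w - \<i> * of_real (of_int m * Y)"
    have re: "Re w' = Re w" unfolding w'_def by simp
    have "of_int m * Y \<le> Im w" "Im w < (of_int m + 1) * Y"
      unfolding m_def by (rule floor_divide_lower[OF Y], rule floor_divide_upper[OF Y])
    then have im: "0 \<le> Im w'" "Im w' \<le> Y" unfolding w'_def by (auto simp: algebra_simps)
    have "k w' = k w"
    proof (cases "0 \<le> m")
      case True
      then have "w = w' + \<i> * of_real (real (nat m) * Y)" unfolding w'_def by simp
      then show ?thesis using pern[of w' "nat m"] w re by metis
    next
      case False
      then have "w' = w + \<i> * of_real (real (nat (- m)) * Y)" unfolding w'_def by simp
      then show ?thesis using pern[OF w, of "nat (- m)"] by simp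
    qed
    then show ?thesis using re im by blast
  qed
  have "\<exists>B. \<forall>z. B < norm z \<longrightarrow> M < norm (f z)" if M: "R < M" for M
  proof -
    define x0 where "x0 = ln M"
    have x0: "ln R < x0" unfolding x0_def using M R by simp
    define V where "V = {w. x0 < Re w}"
    have VH: "V \<subseteq> {w. ln R < Re w}" unfolding V_def using x0 by auto
    have opV: "open V" unfolding V_def by (simp add: open_halfspace_Re_gt)
    have opT: "open (k ` V)"
      by (rule open_image_lift_of_exp[OF opV continuous_on_subset[OF k VH], of f]) (use VH fk in auto)
    define K where "K N = k ` cbox (Complex x0 0) (Complex N Y)" for N
    have cK: "compact (K N)" for N
      unfolding K_def using x0
      by (intro compact_continuous_image continuous_on_subset[OF k]) (auto simp: in_cbox_complex_iff)
    define \<Gamma> where "\<Gamma> = K x0"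
    obtain B where B: "B > 0" "\<Gamma> \<subseteq> ball 0 B"
      using compact_imp_bounded[OF cK[of x0]] bounded_subset_ballD unfolding \<Gamma>_def by metis
    define O1 where "O1 = - cball (0::complex) B"
    have cl: "closedin (top_of_set O1) (k ` V \<inter> O1)"
      unfolding closedin_limpt
    proof (intro conjI allI impI)
      fix z assume z: "z islimpt k ` V \<inter> O1 \<and> z \<in> O1"
      define N where "N = max x0 (ln (norm (f z) + 1))"
      define O2 where "O2 = {y. norm (f y) < norm (f z) + 1}"
      have opO2: "open O2" unfolding O2_def
        by (intro open_Collect_less continuous_intros contf)
      have "z \<in> closure (k ` V)" 
        using z islimpt_subset[of z "k ` V \<inter> O1" "k ` V"] unfolding closure_def by auto
      moreover have "z \<in> O2" unfolding O2_def by simp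
      ultimately have "z \<in> closure (O2 \<inter> k ` V)" using open_Int_closure_subset[OF opO2] by blast
      moreover have "O2 \<inter> k ` V \<subseteq> K N"
      proof
        fix y assume y: "y \<in> O2 \<inter> k ` V"
        then obtain w where w: "x0 < Re w" "y = k w" unfolding V_def by blast
        obtain w' where w': "Re w' = Re w" "0 \<le> Im w'" "Im w' \<le> Y" "k w' = k w"
          using red[of w] w(1) x0 by auto
        have "exp (Re w) = norm (f y)" using fk[of w] w x0 by simp
        also have "\<dots> < norm (f z) + 1" using y unfolding O2_def by auto
        finally have "Re w < ln (norm (f z) + 1)"
          by (metis exp_gt_zero less_trans ln_exp ln_less_cancel_iff)
        then show "y \<in> K N" unfolding K_def using w w' unfolding N_def
          by (intro image_eqI[of _ _ w']) (auto simp: in_cbox_complex_iff)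
      qed
      ultimately have "z \<in> K N" using cK compact_imp_closed closure_minimal by blast
      then obtain w where w: "z = k w" "x0 \<le> Re w" "0 \<le> Im w" "Im w \<le> Y"
        unfolding K_def by (auto simp: in_cbox_complex_iff)
      have "Re w \<noteq> x0"
      proof
        assume "Re w = x0"
        then have "z \<in> \<Gamma>" unfolding \<Gamma>_def K_def using w by (auto simp: in_cbox_complex_iff)
        then show False using B z unfolding O1_def by auto
      qed
      then show "z \<in> k ` V \<inter> O1" using w z unfolding V_def by auto
    qed auto
    have op: "openin (top_of_set O1) (k ` V \<inter> O1)" using opT by (simp add: openin_open_Int Int_commute)
    have "connected O1" unfolding O1_def
      by (rule connected_complement_bounded_convex) auto
    then have "k ` V \<inter> O1 = {} \<or> k ` V \<inter> O1 = O1" using cl op connected_clopen by blast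
    moreover have "k ` V \<inter> O1 \<noteq> {}"
    proof
      assume e: "k ` V \<inter> O1 = {}"
      have "compact (f ` cball 0 B)" using contf by (intro compact_continuous_image) auto
      then obtain C where C: "\<And>z. z \<in> cball 0 B \<Longrightarrow> norm (f z) \<le> C"
        using compact_imp_bounded bounded_iff by (metis image_eqI)
      define w where "w = complex_of_real (max x0 (ln (\<bar>C\<bar> + 1)) + 1)"
      have "w \<in> V" unfolding V_def w_def by simp
      then have "k w \<in> cball 0 B" using e unfolding O1_def by blast
      then have "norm (f (k w)) \<le> C" using C by blast
      moreover have "norm (f (k w)) = exp (Re w)" using fk[of w] \<open>w \<in> V\<close> VH by auto
      moreover have "exp (Re w) > exp (ln (\<bar>C\<bar> + 1))" unfolding w_def by (subst exp_less_cancel_iff) simp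
      ultimately show False by (simp add: abs_le_D1)
    qed
    ultimately have O1V: "O1 \<subseteq> k ` V" by blast
    have "M < norm (f z)" if "B < norm z" for z
    proof -
      have "z \<in> k ` V" using O1V that unfolding O1_def by auto
      then obtain w where w: "w \<in> V" "z = k w" by blast
      then have "norm (f z) = exp (Re w)" using fk[of w] VH by auto
      moreover have "exp (ln M) < exp (Re w)" using w(1) unfolding V_def x0_def by simp
      ultimately show ?thesis using M R by simp
    qed
    then show ?thesis by blast
  qed
  note big = this
  have "filterlim f at_infinity at_infinity"
    unfolding filterlim_at_infinity[OF order_refl]
  proof (intro allI impI)
    fix r :: real assume "0 < r"
    have "R < R + r" using \<open>0 < r\<close> by simp
    then obtain B where "\<And>z. B < norm z \<Longrightarrow> R + r < norm (f z)" using big by blast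
    then have "\<And>z. B + 1 \<le> norm z \<Longrightarrow> r \<le> norm (f z)" using R by (smt (verit))
    then show "\<forall>\<^sub>F x in at_infinity. r \<le> norm (f x)" unfolding eventually_at_infinity by blast
  qed
  then show False using transcendental_entire_not_proper[OF f] by blast
qed

text \<open>On the half-plane \<open>exp\<close> is the universal covering of the exterior of the
  disk of radius \<open>R\<close>, which contains no singular value; so \<open>exp\<close> lifts
  through \<open>f\<close> to a map \<open>k\<close>. Two points with the same image differ by a
  multiple of 2 pi i, and uniqueness of lifts would make \<open>k\<close> periodic, which is
  excluded. The last property says that the image is a full component of the set where
  \<open>norm (f z) > R\<close>.\<close>

lemma tract_parametrization:
  assumes f: "transcendental_entire f" and R: "0 < R" and S: "singular_values f \<subseteq> ball 0 R"
  obtains k where "continuous_on {w. ln R < Re w} k" "\<And>w. ln R < Re w \<Longrightarrow> f (k w) = exp w"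
    "inj_on k {w. ln R < Re w}"
    "\<And>A. connected A \<Longrightarrow> (\<And>z. z \<in> A \<Longrightarrow> R < norm (f z)) \<Longrightarrow> A \<inter> k ` {w. ln R < Re w} \<noteq> {} \<Longrightarrow>
       A \<subseteq> k ` {w. ln R < Re w}"
proof -
  define H where "H = {w. ln R < Re w}"
  have holf: "f holomorphic_on UNIV" using f unfolding transcendental_entire_def by blast
  then have contf: "continuous_on A f" for A
    using holomorphic_on_imp_continuous_on continuous_on_subset by blast
  have opH: "open H" unfolding H_def by (simp add: open_halfspace_Re_gt)
  have cvH: "convex H" unfolding H_def by (simp add: convex_halfspace_Re_gt)
  have Rexp: "R < norm (exp w)" if "w \<in> H" for w
    using that R unfolding H_def by (metis exp_less_cancel_iff exp_ln mem_Collect_eq norm_exp_eq_Re)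
  have reg: "exp w \<notin> singular_values f" if "w \<in> H" for w using Rexp[OF that] S by auto
  obtain z1 where z1: "R < norm (f z1)"
  proof -
    have "\<not> bounded (range f)"
      using Liouville_theorem[OF holf] transcendental_entire_not_constant[OF f] by (auto simp: constant_on_def)
    then show ?thesis using that unfolding bounded_iff using not_le by auto
  qed
  define w1 where "w1 = Ln (f z1)"
  have "f z1 \<noteq> 0" using z1 R by auto
  then have w1: "w1 \<in> H" "f z1 = exp w1" unfolding w1_def H_def using z1 R by (auto simp: Re_Ln)
  have "simply_connected H" using cvH convex_imp_simply_connected by blast
  moreover have "continuous_on H exp" by (intro continuous_intros)
  ultimately obtain k where k: "continuous_on H k" "k w1 = z1" "\<And>w. w \<in> H \<Longrightarrow> f (k w) = exp w"
    using lift_simply_connected[OF holf opH, of exp w1 z1] reg w1 by metis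
  have conH: "connected H" using cvH convex_connected by blast
  have inj: "inj_on k H"
  proof (rule inj_onI, rule ccontr)
    fix x y assume xy: "x \<in> H" "y \<in> H" "k x = k y" "x \<noteq> y"
    then have "exp x = exp y" using k(3) by metis
    then obtain n :: int where n: "x = y + (of_int (2 * n) * pi) * \<i>" unfolding exp_eq by blast
    define c :: real where "c = of_int (2 * n) * pi"
    have xc: "x = y + \<i> * of_real c" unfolding c_def n by simp
    have c0: "c \<noteq> 0" using xc xy(4) by auto
    have ex: "exp (w + \<i> * of_real c) = exp w" for w
      unfolding exp_eq c_def by (intro exI[of _ n]) simp
    have per: "k (w + \<i> * of_real c) = k w" if w: "w \<in> H" for w
    proof (rule lift_unique[OF holf conH, of "\<lambda>w. k (w + \<i> * of_real c)" k y])
      show "continuous_on H (\<lambda>w. k (w + \<i> * of_real c))"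
        by (rule continuous_on_compose2[OF k(1)]) (auto simp: H_def intro!: continuous_intros)
      show "f (k (v + \<i> * of_real c)) = f (k v)" "f (k (v + \<i> * of_real c)) \<notin> singular_values f" if "v \<in> H" for v
      proof -
        have "v + \<i> * of_real c \<in> H" using that unfolding H_def by simp
        then show "f (k (v + \<i> * of_real c)) = f (k v)" "f (k (v + \<i> * of_real c)) \<notin> singular_values f"
          using k(3) that ex reg by auto
      qed
    qed (use k(1) xy xc w in auto)
    have per': "k (w - \<i> * of_real c) = k w" if w: "w \<in> H" for w
      using per[of "w - \<i> * of_real c"] w unfolding H_def by simp
    have "k (w + \<i> * of_real \<bar>c\<bar>) = k w" if "w \<in> H" for w
      using per[OF that] per'[OF that] by (cases "0 \<le> c") auto
    then show False
      using lift_of_exp_not_periodic[OF f R, of k "\<bar>c\<bar>"] k(1,3) c0 unfolding H_def by auto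
  qed
  have comp: "A \<subseteq> k ` H" if A: "connected A" "\<And>z. z \<in> A \<Longrightarrow> R < norm (f z)" "A \<inter> k ` H \<noteq> {}" for A
  proof
    fix z assume z: "z \<in> A"
    define O1 where "O1 = {z. R < norm (f z)}"
    have opO: "open O1" unfolding O1_def by (intro open_Collect_less continuous_intros contf)
    obtain w0 where w0: "w0 \<in> H" "k w0 \<in> A" using A(3) by blast
    have "A \<subseteq> O1" using A(2) unfolding O1_def by blast
    then have "connected_component O1 (k w0) z"
      using A(1) w0(2) z unfolding connected_component_def by blast
    then have "path_component O1 (k w0) z" using opO by (simp add: open_path_connected_component)
    then obtain q where q: "path q" "path_image q \<subseteq> O1" "pathstart q = k w0" "pathfinish q = z"
      unfolding path_component_def by blast
    have qO: "R < norm (f (q t))" if "t \<in> {0..1}" for t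
      using q(2) that unfolding path_image_def O1_def by blast
    have cq: "continuous_on {0..1} q" using q(1) unfolding path_def .
    have cfq: "continuous_on {0..1} (\<lambda>t. f (q t))"
      by (rule continuous_on_compose2[OF contf[of UNIV] cq]) auto
    have nz: "f (q t) \<noteq> 0" if "t \<in> {0..1}" for t using qO[OF that] R by auto
    obtain g where g: "continuous_on {0..1} g" "\<And>t. t \<in> {0..1} \<Longrightarrow> f (q t) = exp (g t)"
      using continuous_logarithm_on_contractible[OF cfq convex_imp_contractible nz] by auto
    \<comment> \<open>The logarithm of \<open>f\<close> along \<open>q\<close> is shifted to start
      at \<open>w0\<close>. Then \<open>k\<close> along \<open>g'\<close> and \<open>q\<close> are
      lifts of the same path from the same point.\<close>
    define g' where "g' t = g t - (g 0 - w0)" for t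
    have q0: "q 0 = k w0" "q 1 = z" using q(3,4) unfolding pathstart_def pathfinish_def by auto
    have "exp (g 0) = exp w0" using g(2)[of 0] q0 k(3)[OF w0(1)] by simp
    then have g'e: "exp (g' t) = f (q t)" if "t \<in> {0..1}" for t
      using g(2)[OF that] unfolding g'_def by (simp add: exp_diff)
    have g'H: "g' t \<in> H" if "t \<in> {0..1}" for t
    proof -
      have "R < exp (Re (g' t))" using qO[OF that] unfolding g'e[OF that, symmetric] by simp
      then show ?thesis unfolding H_def using R by (metis exp_gt_zero ln_exp ln_less_cancel_iff mem_Collect_eq)
    qed
    have "k (g' 1) = q 1"
    proof (rule lift_unique[OF holf, of "{0..1::real}" "\<lambda>t. k (g' t)" q 0])
      show "continuous_on {0..1} (\<lambda>t. k (g' t))"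
        by (rule continuous_on_compose2[OF k(1)]) (use g'H g(1) in \<open>auto simp: g'_def intro!: continuous_intros\<close>)
      show "f (k (g' t)) = f (q t)" "f (k (g' t)) \<notin> singular_values f" if "t \<in> {0..1}" for t
        using k(3)[OF g'H[OF that]] g'e[OF that] reg[OF g'H[OF that]] by auto
      show "k (g' 0) = q 0" unfolding g'_def q0 by simp
    qed (use cq in auto)
    then show "z \<in> k ` H" using g'H[of 1] q0 by auto
  qed
  show ?thesis
    using that[of k] k(1,3) inj comp unfolding H_def by blast
qed

text \<open>On the tract \<open>k ` H\<close>, both \<open>k\<close> and a logarithm of \<open>k\<close> are coordinates; at a point whose image
  under \<open>f\<close> is also in the tract they differ by a multiple of \<open>2\<pi>i\<close>, which is the label of the
  component.\<close>

lemma disjoint_unbounded_preimages: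
  assumes f: "transcendental_entire f" and bd: "bounded (singular_values f)"
    and X0: "closed X0" "connected X0" "\<not> bounded X0"
  obtains X :: "nat \<Rightarrow> complex set" where "\<And>n. closed (X n)" "\<And>n. connected (X n)" "\<And>n. \<not> bounded (X n)"
    "\<And>m n. m \<noteq> n \<Longrightarrow> X m \<inter> X n = {}" "\<And>n z. z \<in> X n \<Longrightarrow> f (f z) \<in> X0"
proof -
  have holf: "f holomorphic_on UNIV" using f unfolding transcendental_entire_def by blast
  note nc = transcendental_entire_not_constant[OF f]
  obtain R0 where R0: "singular_values f \<subseteq> ball 0 R0" using bd bounded_subset_ballD by blast
  \<comment> \<open>\<open>norm (f 0) < R\<close> keeps 0 out of the tract, so that \<open>k\<close>
    has no zero and admits the logarithm \<open>lk\<close>.\<close>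
  define R where "R = max (max 1 R0) (norm (f 0) + 1)"
  have R: "0 < R" "norm (f 0) < R" "singular_values f \<subseteq> ball 0 R" using R0 unfolding R_def by auto
  define H where "H = {w. ln R < Re w}"
  obtain k where k: "continuous_on H k" "\<And>w. w \<in> H \<Longrightarrow> f (k w) = exp w" "inj_on k H"
    "\<And>A. connected A \<Longrightarrow> (\<And>z. z \<in> A \<Longrightarrow> R < norm (f z)) \<Longrightarrow> A \<inter> k ` H \<noteq> {} \<Longrightarrow> A \<subseteq> k ` H"
    using tract_parametrization[OF f R(1,3)] unfolding H_def by (metis mem_Collect_eq)
  have opH: "open H" unfolding H_def by (simp add: open_halfspace_Re_gt)
  have cvH: "convex H" unfolding H_def by (simp add: convex_halfspace_Re_gt)
  have Rexp: "R < norm (exp w)" if "w \<in> H" for w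
    using that R(1) unfolding H_def by (metis exp_less_cancel_iff exp_ln mem_Collect_eq norm_exp_eq_Re)
  have k0: "k w \<noteq> 0" if "w \<in> H" for w using k(2)[OF that] Rexp[OF that] R(2) by (metis less_asym)
  obtain lk where lk: "continuous_on H lk" "\<And>w. w \<in> H \<Longrightarrow> k w = exp (lk w)"
    using continuous_logarithm_on_contractible[OF k(1) convex_imp_contractible[OF cvH] k0] by blast
  define \<kappa> where "\<kappa> = inv_into H k"
  have \<kappa>: "\<kappa> (k w) = w" if "w \<in> H" for w unfolding \<kappa>_def using k(3) that by simp
  have c\<kappa>: "continuous_on (k ` H) \<kappa>" by (rule continuous_on_inverse_open[OF opH k(1)]) (use \<kappa> in auto)
  have Lnin: "w \<in> H" if "exp w = z" "R < norm z" for w z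
    using that R(1) unfolding H_def by (metis exp_gt_zero ln_exp ln_less_cancel_iff mem_Collect_eq norm_exp_eq_Re)
  \<comment> \<open>Trimming to moduli at least \<open>R + 1\<close> makes
    \<open>norm (f z) > R\<close> on the pulled back component, which therefore stays in one tract.
    The same is done before the second pullback.\<close>
  obtain X0' where X0': "X0' \<subseteq> X0" "closed X0'" "connected X0'" "\<not> bounded X0'" "\<And>z. z \<in> X0' \<Longrightarrow> R + 1 \<le> norm z"
    using unbounded_closed_connected_subset_norm_ge[OF X0, of "R + 1"] by metis
  obtain x0 where x0: "x0 \<in> X0'" using X0'(4) by fastforce
  have x0R: "R < norm x0" using X0'(5)[OF x0] by simp
  then have "x0 \<noteq> 0" using R(1) by auto
  then have w0: "Ln x0 \<in> H" "exp (Ln x0) = x0" using Lnin[of "Ln x0" x0] x0R by auto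
  define X1 where "X1 = connected_component_set (f -` X0') (k (Ln x0))"
  have fx0: "f (k (Ln x0)) \<in> X0'" using k(2) w0 x0 by simp
  have X1: "closed X1" "connected X1" "\<not> bounded X1" "X1 \<subseteq> f -` X0'" "k (Ln x0) \<in> X1"
    unfolding X1_def using unbounded_component_vimage[OF holf nc X0'(2-4) fx0] connected_component_subset fx0
    by auto
  have X1T: "X1 \<subseteq> k ` H"
  proof (rule k(4)[OF X1(2)])
    show "R < norm (f z)" if "z \<in> X1" for z using X1(4) X0'(5)[of "f z"] that by fastforce
  qed (use X1(5) w0 in blast)
  obtain X1' where X1': "X1' \<subseteq> X1" "closed X1'" "connected X1'" "\<not> bounded X1'" "\<And>z. z \<in> X1' \<Longrightarrow> R + 1 \<le> norm z"
    using unbounded_closed_connected_subset_norm_ge[OF X1(1-3), of "R + 1"] by metis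
  obtain x1 where x1: "x1 \<in> X1'" using X1'(4) by fastforce
  then obtain v where v: "v \<in> H" "x1 = k v" using X1'(1) X1T by blast
  \<comment> \<open>The logarithms of \<open>x1 = exp (lk v)\<close> differ by multiples of 2 pi i
    and are all in \<open>H\<close>, because \<open>norm x1 > R\<close>. Their images under
    \<open>k\<close> are infinitely many preimages of \<open>x1\<close> in the same tract, with
    labels \<open>n\<close>.\<close>
  define z where "z n = k (lk v + of_nat n * (2 * of_real pi * \<i>))" for n :: nat
  have ez: "exp (lk v + of_nat n * (2 * of_real pi * \<i>)) = x1" for n
    using lk(2)[OF v(1)] v(2) by (simp add: exp_add exp_of_nat_mult)
  have vn: "lk v + of_nat n * (2 * of_real pi * \<i>) \<in> H" for n
    by (rule Lnin[OF ez]) (use X1'(5)[OF x1] in simp)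
  have fz: "f (z n) = x1" for n unfolding z_def using k(2)[OF vn] ez by simp
  define X where "X n = connected_component_set (f -` X1') (z n)" for n
  have X: "closed (X n)" "connected (X n)" "\<not> bounded (X n)" "X n \<subseteq> f -` X1'" "z n \<in> X n" for n
    unfolding X_def using unbounded_component_vimage[OF holf nc X1'(2-4), of "z n"] connected_component_subset fz x1
    by auto
  have XT: "X n \<subseteq> k ` H" for n
  proof (rule k(4)[OF X(2)])
    show "R < norm (f z)" if "z \<in> X n" for z using X(4)[of n] X1'(5)[of "f z"] that by fastforce
  qed (use X(5) vn z_def in blast)
  have fXT: "f ` X n \<subseteq> k ` H" for n using X(4)[of n] X1'(1) X1T by blast
  define L where "L y = (\<kappa> y - lk (\<kappa> (f y))) / (2 * of_real pi * \<i>)" for y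
  have Lint: "L y \<in> \<int>" if yX: "y \<in> X n" for y n
  proof -
    obtain a where a: "a \<in> H" "y = k a" using XT yX by blast
    obtain c where c: "c \<in> H" "f y = k c" using fXT yX by blast
    have "exp a = exp (lk c)" using k(2)[OF a(1)] a(2) c(2) lk(2)[OF c(1)] by simp
    then obtain j :: int where "a = lk c + (of_int (2 * j) * pi) * \<i>" unfolding exp_eq by blast
    then have "L y = of_int j" unfolding L_def using \<kappa>[OF a(1)] \<kappa>[OF c(1)] a(2) c(2) by (simp add: field_simps)
    then show ?thesis by simp
  qed
  have Lc: "L constant_on X n" for n
  proof (rule continuous_discrete_range_constant[OF X(2)])
    have "continuous_on (X n) (\<lambda>y. \<kappa> (f y))"
      by (rule continuous_on_compose2[OF c\<kappa>])
         (use fXT holf holomorphic_on_imp_continuous_on holomorphic_on_subset in blast)+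
    then have "continuous_on (X n) (\<lambda>y. lk (\<kappa> (f y)))"
      using fXT \<kappa> by (intro continuous_on_compose2[OF lk(1)]) fastforce+
    then show "continuous_on (X n) L"
      unfolding L_def by (intro continuous_intros continuous_on_subset[OF c\<kappa> XT]) auto
    show "\<exists>e>0. \<forall>y. y \<in> X n \<and> L y \<noteq> L x \<longrightarrow> e \<le> norm (L y - L x)" if xX: "x \<in> X n" for x
    proof (intro exI[of _ 1] conjI allI impI)
      fix y assume y: "y \<in> X n \<and> L y \<noteq> L x"
      obtain i j :: int where "L x = of_int i" "L y = of_int j" using Lint[OF xX] Lint[of y n] y by (metis Ints_cases)
      moreover have "1 \<le> \<bar>j - i\<bar>" using calculation y by auto
      ultimately show "1 \<le> norm (L y - L x)" by (metis norm_of_int of_int_1_le_iff of_int_abs of_int_diff)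
    qed simp
  qed
  have Lz: "L (z n) = of_nat n" for n
  proof -
    have "\<kappa> (z n) = lk v + of_nat n * (2 * of_real pi * \<i>)" unfolding z_def using \<kappa>[OF vn] .
    moreover have "\<kappa> (f (z n)) = v" unfolding fz v(2) using \<kappa>[OF v(1)] .
    ultimately show ?thesis unfolding L_def by simp
  qed
  have LX: "L y = of_nat n" if "y \<in> X n" for y n
    using Lc[of n] that X(5)[of n] Lz[of n] unfolding constant_on_def by metis
  show ?thesis
  proof (rule that[of X])
    show "X m \<inter> X n = {}" if "m \<noteq> n" for m n using LX[of _ m] LX[of _ n] that by (metis disjoint_iff of_nat_eq_iff)
    show "f (f y) \<in> X0" if "y \<in> X n" for n y using X(4)[of n] X1'(1) X1(4) X0'(1) that by blast
  qed (use X in auto)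
qed

section \<open>The boundary of the Siegel disk\<close>

lemma open_Fatou_set: "open (Fatou_set f)"
proof (rule openI)
  fix z assume "z \<in> Fatou_set f"
  then obtain D where D: "open D" "connected D" "z \<in> D" "normal_family_on (range (\<lambda>n. f ^^ n)) D"
    unfolding Fatou_set_def by blast
  then have "D \<subseteq> Fatou_set f" unfolding Fatou_set_def by blast
  then show "\<exists>e>0. ball z e \<subseteq> Fatou_set f" using D(1,3) by (meson open_contains_ball order_trans)
qed

text \<open>Simple connectivity amounts to the complement having no bounded component. A
  complementary component that meets \<open>E\<close> contains one of the unbounded sets
  \<open>K\<close>. Every other point \<open>x\<close> is in a different component of
  \<open>- E\<close>, whose closure reaches \<open>E\<close>, since otherwise that component would
  be clopen in the plane.\<close>

lemma simply_connected_component_of_complement: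
  fixes E :: "complex set"
  assumes E: "closed E" and un: "\<And>x. x \<in> E \<Longrightarrow> \<exists>K. connected K \<and> \<not> bounded K \<and> x \<in> K \<and> K \<subseteq> E"
    and u: "u \<notin> E"
  shows "simply_connected (connected_component_set (- E) u)"
proof -
  define \<Omega> where "\<Omega> = connected_component_set (- E) u"
  have op: "open \<Omega>" unfolding \<Omega>_def using E by (intro open_connected_component) auto
  have con: "connected \<Omega>" unfolding \<Omega>_def by simp
  have sub: "\<Omega> \<subseteq> - E" unfolding \<Omega>_def by (rule connected_component_subset)
  have u\<Omega>: "u \<in> \<Omega>" unfolding \<Omega>_def using u by simp
  have inE: "\<not> bounded (connected_component_set (- \<Omega>) y)" if "y \<in> E" for y
  proof -
    obtain K where K: "connected K" "\<not> bounded K" "y \<in> K" "K \<subseteq> E" using un \<open>y \<in> E\<close> by blast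
    then have "K \<subseteq> connected_component_set (- \<Omega>) y"
      using sub by (intro connected_component_maximal) auto
    then show ?thesis using K(2) bounded_subset by blast
  qed
  have "\<not> bounded C" if C: "C \<in> components (- \<Omega>)" for C
  proof -
    obtain x where x: "x \<in> - \<Omega>" "C = connected_component_set (- \<Omega>) x" using C unfolding components_def by blast
    show ?thesis
    proof (cases "x \<in> E")
      case True
      then show ?thesis using inE x by blast
    next
      case False
      define \<Omega>' where "\<Omega>' = connected_component_set (- E) x"
      have op': "open \<Omega>'" unfolding \<Omega>'_def using E by (intro open_connected_component) auto
      have x': "x \<in> \<Omega>'" unfolding \<Omega>'_def using False by simp
      have con': "connected (closure \<Omega>')" unfolding \<Omega>'_def by (simp add: connected_imp_connected_closure)
      have dis: "\<Omega>' \<inter> \<Omega> = {}"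
        using x(1) unfolding \<Omega>_def \<Omega>'_def
        by (metis ComplD connected_component_disjoint connected_component_eq x' \<Omega>'_def inf_commute)
      then have dis': "closure \<Omega>' \<inter> \<Omega> = {}" 
        using open_Int_closure_eq_empty[OF op, of \<Omega>'] by (simp add: Int_commute)
      have "closure \<Omega>' \<inter> E \<noteq> {}"
      proof
        assume "closure \<Omega>' \<inter> E = {}"
        then have "closure \<Omega>' \<subseteq> connected_component_set (- E) x"
          using con' x' closure_subset[of \<Omega>'] by (intro connected_component_maximal) blast+
        then have "closure \<Omega>' \<subseteq> \<Omega>'" unfolding \<Omega>'_def .
        then have "closed \<Omega>'" using closure_subset_eq by blast
        then have "\<Omega>' = UNIV" using op' x' clopen[of \<Omega>'] by blast
        then show False using dis u\<Omega> by blast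
      qed
      then obtain y where y: "y \<in> closure \<Omega>'" "y \<in> E" by blast
      have "closure \<Omega>' \<subseteq> C"
        unfolding x(2) using con' x' dis' closure_subset by (intro connected_component_maximal) blast+
      then have "C = connected_component_set (- \<Omega>) y"
        using y(1) x(2) connected_component_eq by blast
      then show ?thesis using inE y(2) by simp
    qed
  qed
  then show ?thesis
    using simply_connected_eq_unbounded_complement_components[OF op] con unfolding \<Omega>_def by blast
qed

section \<open>The Siegel disk: separation from the singular values and the inverse branch\<close>

locale Siegel_disk_class_B =
  fixes f :: "complex \<Rightarrow> complex" and U :: "complex set"
  assumes te: "transcendental_entire f" and bd: "bounded (singular_values f)"
    and SJ: "singular_values f \<subseteq> Julia_set f" and SD: "Siegel_disk f U"
    and Sfr: "singular_values f \<inter> frontier U = {}"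
begin

lemma holf: "f holomorphic_on UNIV" using te unfolding transcendental_entire_def by blast

lemma contf: "continuous_on A f"
  using holf holomorphic_on_imp_continuous_on continuous_on_subset by blast

lemma open_U: "open U"
  using SD open_components[OF open_Fatou_set] unfolding Siegel_disk_def by blast

lemma simply_connected_U: "simply_connected U" using SD unfolding Siegel_disk_def by blast

lemma image_U: "f ` U = U" using SD unfolding Siegel_disk_def by blast

lemma funpow_U: "z \<in> U \<Longrightarrow> (f ^^ n) z \<in> U"
  using image_U by (induction n) auto

lemma homeo_U: "\<exists>\<psi> \<psi>'. homeomorphism (ball (0::complex) 1) U \<psi> \<psi>'"
  and inj_U: "inj_on f U"
proof -
  obtain \<phi> \<theta> where \<phi>: "\<phi> holomorphic_on U" "bij_betw \<phi> U (ball 0 1)"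
    "\<And>z. z \<in> U \<Longrightarrow> \<phi> (f z) = cis (2 * pi * \<theta>) * \<phi> z"
    using SD unfolding Siegel_disk_def by blast
  have inj: "inj_on \<phi> U" and im: "\<phi> ` U = ball 0 1" using \<phi>(2) unfolding bij_betw_def by auto
  obtain \<psi> where "homeomorphism U (\<phi> ` U) \<phi> \<psi>"
    using invariance_of_domain_homeomorphism[OF open_U holomorphic_on_imp_continuous_on[OF \<phi>(1)] _ inj] by auto
  then show "\<exists>\<psi> \<psi>'. homeomorphism (ball (0::complex) 1) U \<psi> \<psi>'"
    unfolding im using homeomorphism_symD by blast
  show "inj_on f U"
  proof (rule inj_onI)
    fix x y assume xy: "x \<in> U" "y \<in> U" "f x = f y"
    then have "\<phi> x = \<phi> y" using \<phi>(3)[of x] \<phi>(3)[of y] by (simp add: cis_neq_zero)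
    then show "x = y" using inj xy by (auto dest: inj_onD)
  qed
qed

lemma ne_U: "U \<noteq> {}"
  using homeo_U unfolding homeomorphism_def by (metis ball_eq_empty image_is_empty not_one_le_zero)

lemma singular_values_closure_U: "singular_values f \<inter> closure U = {}"
proof -
  have "U \<subseteq> Fatou_set f" using SD in_components_subset unfolding Siegel_disk_def by blast
  then have "singular_values f \<inter> U = {}" using SJ unfolding Julia_set_def by blast
  then show ?thesis using Sfr open_U unfolding frontier_def by (auto simp: interior_open)
qed

text \<open>Needed to pull continua back under an iterate. The iterate maps the infinite set
  \<open>U\<close> onto itself.\<close>

lemma funpow_not_constant: "\<not> (f ^^ n) constant_on UNIV"
proof
  assume "(f ^^ n) constant_on UNIV"
  then obtain c where c: "\<And>z. (f ^^ n) z = c" unfolding constant_on_def by auto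
  have "(f ^^ n) ` U = U"
  proof (induction n)
    case (Suc n)
    then show ?case using image_U by (metis funpow.simps(2) image_comp)
  qed simp
  then have "U \<subseteq> {c}" using c by auto
  then have "finite U" using finite_subset by blast
  then show False using open_U ne_U by (meson finite_imp_not_open)
qed

lemma unbounded_continuum_avoiding_U:
  assumes fr: "frontier U \<noteq> {}" and s: "s \<in> singular_values f" and e: "0 < e" and sU: "closure U \<inter> cball s e = {}"
  obtains A where "closed A" "connected A" "\<not> bounded A" "A \<inter> sphere s e \<noteq> {}" "A \<inter> closure U = {}"
proof -
  \<comment> \<open>A boundary point of the open set \<open>U\<close> shows that the complement of
    \<open>U\<close> is nonempty, so it has a component; this is unbounded because \<open>U\<close>
    is simply connected.\<close>
  obtain x where x: "x \<in> frontier U" using fr by blast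
  then have xU: "x \<in> - U" using open_U unfolding frontier_def by (auto simp: interior_open)
  define X0 where "X0 = connected_component_set (- U) x"
  have "X0 \<in> components (- U)" unfolding X0_def components_def using xU by blast
  then have X0: "\<not> bounded X0"
    using simply_connected_eq_unbounded_complement_components[OF open_U] simply_connected_U by blast
  have X0': "closed X0" "connected X0" "X0 \<subseteq> - U"
    unfolding X0_def using open_U connected_component_subset by (auto intro: closed_connected_component)
  obtain X :: "nat \<Rightarrow> complex set" where X: "\<And>n. closed (X n)" "\<And>n. connected (X n)" "\<And>n. \<not> bounded (X n)"
    "\<And>m n. m \<noteq> n \<Longrightarrow> X m \<inter> X n = {}" "\<And>n z. z \<in> X n \<Longrightarrow> f (f z) \<in> X0"
    using disjoint_unbounded_preimages[OF te bd X0'(1,2) X0] by blast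
  \<comment> \<open>Iterates map \<open>U\<close> into itself, so the preimage of a set that misses
    \<open>U\<close> misses \<open>U\<close>. The same argument is used for the \<open>N\<close>-th
    iterate in \<open>AU\<close>.\<close>
  have XU: "X n \<inter> U = {}" for n
  proof -
    have "f (f z) \<in> U" if "z \<in> U" for z using funpow_U[OF that, of 2] by (simp add: numeral_2_eq_2)
    then show ?thesis using X(5) X0'(3) by blast
  qed
  have "\<exists>a b. a \<in> X n \<and> b \<in> X n \<and> a \<noteq> b" for n
  proof (rule ccontr)
    assume c: "\<not> ?thesis"
    have "X n \<noteq> {}" using X(3)[of n] by auto
    then obtain a where "a \<in> X n" by blast
    then have "X n \<subseteq> {a}" using c by blast
    then show False using X(3)[of n] by (meson bounded_empty bounded_insert bounded_subset)
  qed
  then obtain a b where ab: "\<And>n. a n \<in> X n \<and> b n \<in> X n \<and> a n \<noteq> b n" by metis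
  have "s \<in> Julia_set f" using s SJ by blast
  then have "\<exists>N. \<forall>i\<in>{..<3}. (f ^^ N) ` ball s e \<inter> X i \<noteq> {}"
    using ab e by (intro iterated_images_of_Julia_neighbourhood[OF holf, of s "ball s e" "{..<3::nat}" a X b]) auto
  then obtain N where N: "\<And>i. i < 3 \<Longrightarrow> (f ^^ N) ` ball s e \<inter> X i \<noteq> {}" by auto
  define h where "h = f ^^ N"
  have h: "h holomorphic_on UNIV" "\<not> h constant_on UNIV"
    unfolding h_def using holomorphic_on_funpow[OF holf] funpow_not_constant by auto
  have "\<exists>w. w \<in> ball s e \<and> h w \<in> X i" if "i < 3" for i using N[OF that] unfolding h_def by blast
  then obtain w where w: "\<And>i. i < 3 \<Longrightarrow> w i \<in> ball s e" "\<And>i. i < 3 \<Longrightarrow> h (w i) \<in> X i" by metis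
  have "\<exists>Y. Y \<subseteq> h -` X i \<and> closed Y \<and> connected Y \<and> \<not> bounded Y \<and> Y \<inter> ball s e = {} \<and> Y \<inter> sphere s e \<noteq> {}"
    if i: "i < 3" for i
  proof -
    let ?B = "connected_component_set (h -` X i) (w i)"
    have B: "closed ?B" "connected ?B" "\<not> bounded ?B"
      using unbounded_component_vimage[OF h X(1-3) w(2)[OF i]] by auto
    have "w i \<in> ?B" using w(2)[OF i] by simp
    then have "?B \<inter> cball s e \<noteq> {}" using w(1)[OF i] ball_subset_cball by blast
    then obtain Y where "Y \<subseteq> ?B" "closed Y" "connected Y" "\<not> bounded Y" "Y \<inter> ball s e = {}"
      "Y \<inter> sphere s e \<noteq> {}" using unbounded_component_outside_ball[OF B] by metis
    then show ?thesis using connected_component_subset by (metis order_trans)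
  qed
  then obtain A where A: "\<And>i. i < 3 \<Longrightarrow> A i \<subseteq> h -` X i \<and> closed (A i) \<and> connected (A i) \<and> \<not> bounded (A i) \<and>
      A i \<inter> ball s e = {} \<and> A i \<inter> sphere s e \<noteq> {}" by metis
  obtain \<psi> \<psi>' where hom: "homeomorphism (ball (0::complex) 1) U \<psi> \<psi>'" using homeo_U by blast
  have AU: "A i \<inter> U = {}" if "i < 3" for i
    using A[OF that] XU[of i] funpow_U[of _ N] unfolding h_def by blast
  have AA: "A i \<inter> A j = {}" if "i < 3" "j < 3" "i \<noteq> j" for i j
    using A[OF that(1)] A[OF that(2)] X(4)[OF that(3)] by blast
  have "\<exists>i<3. A i \<inter> closure U = {}"
    by (rule three_unbounded_continua[OF hom open_U, of A s e]) (use A AU AA e sU in auto)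
  then show ?thesis using A that by blast
qed

text \<open>A disk around a singular value alone would be a hole in the complement of
  \<open>E\<close>. Attaching the continuum connects it to infinity without touching the closure of
  \<open>U\<close>. By compactness finitely many such sets suffice, which keeps their union
  closed.\<close>

lemma closed_set_separating_singular_values:
  assumes fr: "frontier U \<noteq> {}"
  obtains E where "closed E" "singular_values f \<subseteq> E" "E \<inter> closure U = {}"
    "\<And>x. x \<in> E \<Longrightarrow> \<exists>K. connected K \<and> \<not> bounded K \<and> x \<in> K \<and> K \<subseteq> E"
proof -
  have "\<exists>e K. 0 < e \<and> ball s e \<subseteq> K \<and> closed K \<and> connected K \<and> \<not> bounded K \<and> K \<inter> closure U = {}"
    if s: "s \<in> singular_values f" for s
  proof -
    have "s \<in> - closure U" "open (- closure U)" using s singular_values_closure_U by auto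
    then obtain e where e: "0 < e" "cball s e \<subseteq> - closure U" using open_contains_cball by blast
    have d: "closure U \<inter> cball s e = {}" using e(2) by blast
    obtain A where A: "closed A" "connected A" "\<not> bounded A" "A \<inter> sphere s e \<noteq> {}" "A \<inter> closure U = {}"
      using unbounded_continuum_avoiding_U[OF fr s e(1) d] by blast
    have "connected (cball s e \<union> A)"
      using A(2,4) sphere_cball by (intro connected_Un) auto
    moreover have "\<not> bounded (cball s e \<union> A)" using A(3) by simp
    moreover have "closed (cball s e \<union> A)" using A(1) by blast
    moreover have "(cball s e \<union> A) \<inter> closure U = {}" using d A(5) by blast
    moreover have "ball s e \<subseteq> cball s e \<union> A" using ball_subset_cball by blast
    ultimately show ?thesis using e(1) by blast
  qed
  then obtain e K where eK: "\<And>s. s \<in> singular_values f \<Longrightarrow> 0 < e s \<and> ball s (e s) \<subseteq> K s \<and> closed (K s) \<and>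
      connected (K s) \<and> \<not> bounded (K s) \<and> K s \<inter> closure U = {}" by metis
  have "compact (singular_values f)"
    using bd unfolding singular_values_def by (simp add: compact_eq_bounded_closed)
  then obtain I where I: "I \<subseteq> singular_values f" "finite I" "singular_values f \<subseteq> (\<Union>s\<in>I. ball s (e s))"
  proof (rule compactE_image)
    show "singular_values f \<subseteq> (\<Union>s\<in>singular_values f. ball s (e s))" using eK by force
  qed auto
  show ?thesis
  proof (rule that[of "\<Union>s\<in>I. K s"])
    show "closed (\<Union>s\<in>I. K s)" using I eK by (intro closed_UN) auto
    show "singular_values f \<subseteq> (\<Union>s\<in>I. K s)" using I eK by blast
    show "(\<Union>s\<in>I. K s) \<inter> closure U = {}" using I eK by blast
    show "\<exists>L. connected L \<and> \<not> bounded L \<and> x \<in> L \<and> L \<subseteq> (\<Union>s\<in>I. K s)" if "x \<in> (\<Union>s\<in>I. K s)" for x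
      using that I(1) eK by blast
  qed
qed

text \<open>Injectivity on \<open>U\<close> does not pass to the boundary by continuity, but a left
  inverse does: the identity \<open>g (f z) = z\<close> is a closed condition once \<open>g\<close>
  is continuous on a neighbourhood of the closure of \<open>U\<close>.\<close>

lemma homeomorphism_frontier: "\<exists>g. homeomorphism (frontier U) (frontier U) f g"
proof (cases "frontier U = {}")
  case True
  then show ?thesis by (simp add: homeomorphism_def)
next
  case False
  obtain E where E: "closed E" "singular_values f \<subseteq> E" "E \<inter> closure U = {}"
    "\<And>x. x \<in> E \<Longrightarrow> \<exists>K. connected K \<and> \<not> bounded K \<and> x \<in> K \<and> K \<subseteq> E"
    using closed_set_separating_singular_values[OF False] by blast
  obtain u where u: "u \<in> U" using ne_U by blast
  define \<Omega> where "\<Omega> = connected_component_set (- E) u"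
  have "connected (closure U)"
    using simply_connected_U simply_connected_imp_connected connected_imp_connected_closure by blast
  then have U\<Omega>: "closure U \<subseteq> \<Omega>"
    unfolding \<Omega>_def using E(3) u closure_subset by (intro connected_component_maximal) blast+
  have UU: "U \<subseteq> closure U" by (rule closure_subset)
  have op: "open \<Omega>" unfolding \<Omega>_def using E(1) by (intro open_connected_component) auto
  have sub: "\<Omega> \<subseteq> - E" unfolding \<Omega>_def by (rule connected_component_subset)
  have "u \<notin> E" using u E(3) UU by blast
  then have sc: "simply_connected \<Omega>"
    unfolding \<Omega>_def using simply_connected_component_of_complement[OF E(1,4)] by blast
  have reg: "w \<notin> singular_values f" if "w \<in> \<Omega>" for w using that sub E(2) by blast
  have fu: "f u \<in> \<Omega>" using u image_U U\<Omega> UU by blast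
  \<comment> \<open>The inverse branch is the lift of the identity through \<open>f\<close>. The
    base point \<open>f u\<close> with value \<open>u\<close> selects the branch that inverts
    \<open>f\<close> on \<open>U\<close>.\<close>
  obtain g where g: "continuous_on \<Omega> g" "g (f u) = u" "\<And>w. w \<in> \<Omega> \<Longrightarrow> f (g w) = w"
    using lift_simply_connected[OF holf op sc continuous_on_id reg fu refl] by metis
  have fcl: "f z \<in> closure U" if "z \<in> closure U" for z
    using image_closure_subset[OF contf closed_closure, of U U] image_U UU that by blast
  have gf: "g (f z) = z" if z: "z \<in> U" for z
  proof (rule lift_unique[OF holf, of U "\<lambda>z. g (f z)" "\<lambda>z. z" u])
    show "connected U" using simply_connected_U simply_connected_imp_connected by blast
    show "continuous_on U (\<lambda>z. g (f z))"
      by (rule continuous_on_compose2[OF g(1) contf]) (use image_U UU U\<Omega> in blast)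
    show "f (g (f x)) = f x" "f (g (f x)) \<notin> singular_values f" if "x \<in> U" for x
    proof -
      have "f x \<in> \<Omega>" using that image_U UU U\<Omega> by blast
      then show "f (g (f x)) = f x" "f (g (f x)) \<notin> singular_values f" using g(3) reg by auto
    qed
  qed (use u z g(2) in auto)
  have gfc: "g (f z) = z" if z: "z \<in> closure U" for z
  proof -
    have "continuous_on (closure U) (\<lambda>z. g (f z) - z)"
      by (intro continuous_intros continuous_on_compose2[OF g(1) contf]) (use fcl U\<Omega> in blast)
    then have "g (f z) - z = 0"
      using continuous_constant_on_closure[of U "\<lambda>z. g (f z) - z" 0 z] gf z by auto
    then show ?thesis by simp
  qed
  have "g w \<in> U" if "w \<in> U" for w using gf image_U that by (metis imageE)
  then have "g ` U \<subseteq> U" by blast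
  have gcl: "g w \<in> closure U" if "w \<in> closure U" for w
    using image_closure_subset[OF continuous_on_subset[OF g(1) U\<Omega>] closed_closure, of U] \<open>g ` U \<subseteq> U\<close> UU that
    by blast
  have fr: "frontier U = closure U - U" using open_U by (simp add: frontier_def interior_open)
  \<comment> \<open>A boundary point sent into \<open>U\<close> would be recovered by
    \<open>g\<close>, which maps \<open>U\<close> into itself. The converse \<open>gfr\<close>
    follows in the same way with \<open>f\<close> and \<open>g\<close> exchanged.\<close>
  have ffr: "f z \<in> frontier U" if "z \<in> frontier U" for z
  proof -
    have "f z \<notin> U"
    proof
      assume "f z \<in> U"
      then have "g (f z) \<in> U" using \<open>g ` U \<subseteq> U\<close> by blast
      then show False using gfc that fr by auto
    qed
    then show ?thesis using that fcl fr by blast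
  qed
  have gfr: "g w \<in> frontier U" if "w \<in> frontier U" for w
  proof -
    have w: "w \<in> closure U" "w \<notin> U" using that fr by auto
    then have "f (g w) = w" using g(3) U\<Omega> by blast
    then have "g w \<notin> U" using w(2) image_U by (metis imageI)
    then show ?thesis using gcl[OF w(1)] fr by blast
  qed
  have "homeomorphism (frontier U) (frontier U) f g"
  proof (rule homeomorphismI)
    show "continuous_on (frontier U) g"
      using g(1) by (rule continuous_on_subset) (use fr U\<Omega> in blast)
    show "g (f z) = z" if "z \<in> frontier U" for z using gfc that fr by blast
    show "f (g w) = w" if "w \<in> frontier U" for w using g(3) that fr U\<Omega> by blast
  qed (use contf ffr gfr in auto)
  then show ?thesis by blast
qed

end

theorem theorem2:
  fixes f :: "complex \<Rightarrow> complex" and U :: "complex set"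
  assumes "f \<in> class_B"
    and "singular_values f \<subseteq> Julia_set f"
    and "Siegel_disk f U"
    and "singular_values f \<inter> frontier U = {}"
  shows "\<exists>g. homeomorphism (frontier U) (frontier U) f g"
proof -
  interpret Siegel_disk_class_B f U
    using assms by unfold_locales (auto simp: class_B_def)
  show ?thesis by (rule homeomorphism_frontier)
qed

end
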